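(* Let $R$ be a commutative ring and $\eta:R\to R^{(-1)}R$ the canonical map. Then: (i) for each prime ideal $\mathfrak q$ of $R^{(-1)}R$, the localization $(R^{(-1)}R)_{\mathfrak q}$ is a field, canonically isomorphic (via the map induced by $\eta$) to the residue field $\kappa(\mathfrak p)=R_{\mathfrak p}/\mathfrak pR_{\mathfrak p}$, where $\mathfrak p=\eta^{-1}(\mathfrak q)$; (ii) the ring $R^{(-1)}R$ is absolutely flat.
   Context: For $a,b$ in a commutative ring, $b$ is a pointwise inverse of $a$ if $a=a^2b$ and $b=b^2a$. For a subset $S\subseteq R$, $S^{(-1)}R=R[x_s:s\in S]/I$ where $I$ is generated by $sx_s^2-x_s$ and $s^2x_s-s$ ($s\in S$), with canonical map $\eta$; here $S=R$. A commutative ring is absolutely flat if every module over it is flat. *)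

theory Defs
  imports "HOL-Algebra.Algebra" "HOL-Library.Poly_Mapping"
begin

definition type_ring :: "'a::comm_ring_1 ring" where
  "type_ring = \<lparr>carrier = UNIV, monoid.mult = (*), monoid.one = 1, ring.zero = 0, ring.add = (+)\<rparr>"

text \<open>Polynomial ring R[x_s : s in R]: polynomials in variables indexed by the
  elements of R, represented as finitely supported maps from monomials
  (finitely supported maps 'a to nat) to coefficients.\<close>

type_synonym 'a mpoly = "('a \<Rightarrow>\<^sub>0 nat) \<Rightarrow>\<^sub>0 'a"

definition mp_const :: "'a::comm_ring_1 \<Rightarrow> 'a mpoly" where
  "mp_const c = Poly_Mapping.single 0 c"

definition mp_var :: "'a::comm_ring_1 \<Rightarrow> 'a mpoly" where
  "mp_var s = Poly_Mapping.single (Poly_Mapping.single s 1) 1"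

definition pinv_ideal :: "'a::comm_ring_1 mpoly set" where
  "pinv_ideal = genideal type_ring
     ((\<lambda>s. mp_const s * mp_var s ^ 2 - mp_var s) ` UNIV \<union>
      (\<lambda>s. mp_const (s ^ 2) * mp_var s - mp_const s) ` UNIV)"

definition pinv_ring :: "'a::comm_ring_1 mpoly set ring" where
  "pinv_ring = (type_ring :: 'a mpoly ring) Quot pinv_ideal"

definition pinv_eta :: "'a::comm_ring_1 \<Rightarrow> 'a mpoly set" where
  "pinv_eta r = pinv_ideal +>\<^bsub>(type_ring :: 'a mpoly ring)\<^esub> mp_const r"

definition loc_rel :: "('a, 'b) ring_scheme \<Rightarrow> 'a set \<Rightarrow> (('a \<times> 'a) \<times> ('a \<times> 'a)) set" where
  "loc_rel A S = {((a, s), (b, t)). a \<in> carrier A \<and> b \<in> carrier A \<and> s \<in> S \<and> t \<in> S \<and>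
      (\<exists>u\<in>S. u \<otimes>\<^bsub>A\<^esub> ((a \<otimes>\<^bsub>A\<^esub> t) \<ominus>\<^bsub>A\<^esub> (b \<otimes>\<^bsub>A\<^esub> s)) = \<zero>\<^bsub>A\<^esub>)}"

definition loc_class :: "('a, 'b) ring_scheme \<Rightarrow> 'a set \<Rightarrow> 'a \<Rightarrow> 'a \<Rightarrow> ('a \<times> 'a) set" where
  "loc_class A S a s = loc_rel A S `` {(a, s)}"

definition loc_mult :: "('a, 'b) ring_scheme \<Rightarrow> 'a set \<Rightarrow> ('a \<times> 'a) set \<Rightarrow> ('a \<times> 'a) set \<Rightarrow> ('a \<times> 'a) set" where
  "loc_mult A S U V = (\<Union>x\<in>U. \<Union>y\<in>V.
      loc_class A S (fst x \<otimes>\<^bsub>A\<^esub> fst y) (snd x \<otimes>\<^bsub>A\<^esub> snd y))"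

definition loc_add :: "('a, 'b) ring_scheme \<Rightarrow> 'a set \<Rightarrow> ('a \<times> 'a) set \<Rightarrow> ('a \<times> 'a) set \<Rightarrow> ('a \<times> 'a) set" where
  "loc_add A S U V = (\<Union>x\<in>U. \<Union>y\<in>V.
      loc_class A S ((fst x \<otimes>\<^bsub>A\<^esub> snd y) \<oplus>\<^bsub>A\<^esub> (fst y \<otimes>\<^bsub>A\<^esub> snd x))
        (snd x \<otimes>\<^bsub>A\<^esub> snd y))"

definition Localization :: "('a, 'b) ring_scheme \<Rightarrow> 'a set \<Rightarrow> (('a \<times> 'a) set) ring" where
  "Localization A S =
    \<lparr>carrier = (carrier A \<times> S) // loc_rel A S,
     monoid.mult = loc_mult A S,
     monoid.one = loc_class A S \<one>\<^bsub>A\<^esub> \<one>\<^bsub>A\<^esub>,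
     ring.zero = loc_class A S \<zero>\<^bsub>A\<^esub> \<one>\<^bsub>A\<^esub>,
     ring.add = loc_add A S\<rparr>"

definition loc_at :: "('a, 'b) ring_scheme \<Rightarrow> 'a set \<Rightarrow> (('a \<times> 'a) set) ring" where
  "loc_at A p = Localization A (carrier A - p)"

definition loc_map :: "('a, 'b) ring_scheme \<Rightarrow> 'a set \<Rightarrow> 'a \<Rightarrow> ('a \<times> 'a) set" where
  "loc_map A p a = loc_class A (carrier A - p) a \<one>\<^bsub>A\<^esub>"

definition residue_field :: "('a, 'b) ring_scheme \<Rightarrow> 'a set \<Rightarrow> (('a \<times> 'a) set) set ring" where
  "residue_field A p = loc_at A p Quot genideal (loc_at A p) (loc_map A p ` p)"

text \<open>The map A_p -> B_q induced by a ring map f : A -> B with p = f^(-1)(q):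
  a/s is sent to f(a)/f(s).\<close>

definition loc_induced ::
  "('a, 'b) ring_scheme \<Rightarrow> 'a set \<Rightarrow> ('c, 'd) ring_scheme \<Rightarrow> 'c set \<Rightarrow> ('a \<Rightarrow> 'c)
     \<Rightarrow> ('a \<times> 'a) set \<Rightarrow> ('c \<times> 'c) set" where
  "loc_induced A p B q f U = (\<Union>x\<in>U. loc_class B (carrier B - q) (f (fst x)) (f (snd x)))"

definition residue_induced ::
  "('a, 'b) ring_scheme \<Rightarrow> 'a set \<Rightarrow> ('c, 'd) ring_scheme \<Rightarrow> 'c set \<Rightarrow> ('a \<Rightarrow> 'c)
     \<Rightarrow> ('a \<times> 'a) set set \<Rightarrow> ('c \<times> 'c) set" where
  "residue_induced A p B q f V = (\<Union>U\<in>V. loc_induced A p B q f U)"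

definition module_hom ::
  "('a, 'r) ring_scheme \<Rightarrow> ('a, 'm) module \<Rightarrow> ('a, 'n) module \<Rightarrow> ('m \<Rightarrow> 'n) set" where
  "module_hom A M N = {f. f \<in> carrier M \<rightarrow> carrier N \<and>
     (\<forall>x\<in>carrier M. \<forall>y\<in>carrier M. f (x \<oplus>\<^bsub>M\<^esub> y) = f x \<oplus>\<^bsub>N\<^esub> f y) \<and>
     (\<forall>c\<in>carrier A. \<forall>x\<in>carrier M. f (c \<odot>\<^bsub>M\<^esub> x) = c \<odot>\<^bsub>N\<^esub> f x)}"

definition free_lin :: "('a, 'r) ring_scheme \<Rightarrow> 'x set \<Rightarrow> ('x \<Rightarrow> 'a) set" where
  "free_lin A U = {z. (\<forall>x. z x \<in> carrier A) \<and> (\<forall>x. x \<notin> U \<longrightarrow> z x = \<zero>\<^bsub>A\<^esub>) \<and>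
                      finite {x. z x \<noteq> \<zero>\<^bsub>A\<^esub>}}"

definition fl_delta :: "('a, 'r) ring_scheme \<Rightarrow> 'x \<Rightarrow> 'x \<Rightarrow> 'a" where
  "fl_delta A x = (\<lambda>y. if y = x then \<one>\<^bsub>A\<^esub> else \<zero>\<^bsub>A\<^esub>)"

definition fl_add :: "('a, 'r) ring_scheme \<Rightarrow> ('x \<Rightarrow> 'a) \<Rightarrow> ('x \<Rightarrow> 'a) \<Rightarrow> 'x \<Rightarrow> 'a" where
  "fl_add A z w = (\<lambda>x. z x \<oplus>\<^bsub>A\<^esub> w x)"

definition fl_minus :: "('a, 'r) ring_scheme \<Rightarrow> ('x \<Rightarrow> 'a) \<Rightarrow> ('x \<Rightarrow> 'a) \<Rightarrow> 'x \<Rightarrow> 'a" where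
  "fl_minus A z w = (\<lambda>x. z x \<ominus>\<^bsub>A\<^esub> w x)"

definition fl_smult :: "('a, 'r) ring_scheme \<Rightarrow> 'a \<Rightarrow> ('x \<Rightarrow> 'a) \<Rightarrow> 'x \<Rightarrow> 'a" where
  "fl_smult A c z = (\<lambda>x. c \<otimes>\<^bsub>A\<^esub> z x)"

definition tensor_rels ::
  "('a, 'r) ring_scheme \<Rightarrow> ('a, 'n) module \<Rightarrow> ('a, 'm) module \<Rightarrow> ('n \<times> 'm \<Rightarrow> 'a) set" where
  "tensor_rels A N M =
     {fl_minus A (fl_delta A (n1 \<oplus>\<^bsub>N\<^esub> n2, m)) (fl_add A (fl_delta A (n1, m)) (fl_delta A (n2, m)))
        | n1 n2 m. n1 \<in> carrier N \<and> n2 \<in> carrier N \<and> m \<in> carrier M} \<union>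
     {fl_minus A (fl_delta A (n, m1 \<oplus>\<^bsub>M\<^esub> m2)) (fl_add A (fl_delta A (n, m1)) (fl_delta A (n, m2)))
        | n m1 m2. n \<in> carrier N \<and> m1 \<in> carrier M \<and> m2 \<in> carrier M} \<union>
     {fl_minus A (fl_delta A (c \<odot>\<^bsub>N\<^esub> n, m)) (fl_smult A c (fl_delta A (n, m)))
        | c n m. c \<in> carrier A \<and> n \<in> carrier N \<and> m \<in> carrier M} \<union>
     {fl_minus A (fl_delta A (n, c \<odot>\<^bsub>M\<^esub> m)) (fl_smult A c (fl_delta A (n, m)))
        | c n m. c \<in> carrier A \<and> n \<in> carrier N \<and> m \<in> carrier M}"

inductive_set tensor_span ::
  "('a, 'r) ring_scheme \<Rightarrow> ('a, 'n) module \<Rightarrow> ('a, 'm) module \<Rightarrow> ('n \<times> 'm \<Rightarrow> 'a) set"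
  for A N M where
    ts_zero: "(\<lambda>_. \<zero>\<^bsub>A\<^esub>) \<in> tensor_span A N M"
  | ts_rel: "z \<in> tensor_rels A N M \<Longrightarrow> z \<in> tensor_span A N M"
  | ts_add: "z \<in> tensor_span A N M \<Longrightarrow> w \<in> tensor_span A N M \<Longrightarrow> fl_add A z w \<in> tensor_span A N M"
  | ts_smult: "c \<in> carrier A \<Longrightarrow> z \<in> tensor_span A N M \<Longrightarrow> fl_smult A c z \<in> tensor_span A N M"

definition tensor_class ::
  "('a, 'r) ring_scheme \<Rightarrow> ('a, 'n) module \<Rightarrow> ('a, 'm) module \<Rightarrow> ('n \<times> 'm \<Rightarrow> 'a) \<Rightarrow> ('n \<times> 'm \<Rightarrow> 'a) set" where
  "tensor_class A N M z = {w \<in> free_lin A (carrier N \<times> carrier M). fl_minus A w z \<in> tensor_span A N M}"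

definition tensor_carrier ::
  "('a, 'r) ring_scheme \<Rightarrow> ('a, 'n) module \<Rightarrow> ('a, 'm) module \<Rightarrow> ('n \<times> 'm \<Rightarrow> 'a) set set" where
  "tensor_carrier A N M = tensor_class A N M ` free_lin A (carrier N \<times> carrier M)"

definition fl_push ::
  "('a, 'r) ring_scheme \<Rightarrow> ('a, 'n1) module \<Rightarrow> ('n1 \<Rightarrow> 'n2) \<Rightarrow> ('n1 \<times> 'm \<Rightarrow> 'a) \<Rightarrow> ('n2 \<times> 'm \<Rightarrow> 'a)" where
  "fl_push A N' f z = (\<lambda>(n, m). finsum A (\<lambda>n'. z (n', m))
      {n'. n' \<in> carrier N' \<and> f n' = n \<and> z (n', m) \<noteq> \<zero>\<^bsub>A\<^esub>})"

definition tensor_map ::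
  "('a, 'r) ring_scheme \<Rightarrow> ('a, 'n1) module \<Rightarrow> ('a, 'n2) module \<Rightarrow> ('a, 'm) module \<Rightarrow> ('n1 \<Rightarrow> 'n2)
     \<Rightarrow> ('n1 \<times> 'm \<Rightarrow> 'a) set \<Rightarrow> ('n2 \<times> 'm \<Rightarrow> 'a) set" where
  "tensor_map A N' N M f U = (\<Union>z\<in>U. tensor_class A N M (fl_push A N' f z))"

text \<open>M is flat for the test (N', N, f): if f : N' -> N is an injective A-linear map,
  then f (x) id_M : N' (x) M -> N (x) M is injective.  A module is flat iff this holds
  for all such N', N, f (of arbitrary carrier types).\<close>

definition flat_for ::
  "('a, 'r) ring_scheme \<Rightarrow> ('a, 'm) module \<Rightarrow> ('a, 'n1) module \<Rightarrow> ('a, 'n2) module \<Rightarrow> ('n1 \<Rightarrow> 'n2) \<Rightarrow> bool" where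
  "flat_for A M N' N f \<longleftrightarrow>
     (module A N' \<and> module A N \<and> f \<in> module_hom A N' N \<and> inj_on f (carrier N') \<longrightarrow>
      inj_on (tensor_map A N' N M f) (tensor_carrier A N' M))"

end

theory Submission
  imports Defs
begin

text \<open>
  Write \<open>B\<close> for the pointwise inverse ring, \<open>x s\<close> for the pointwise inverse of \<open>\<eta> s\<close>, and note that
  \<open>\<eta> s x s\<close> is idempotent. Pointwise inverses are unique, hence multiplicative, so cutting along these
  idempotents turns sums of fractions \<open>\<eta> a x s\<close> into fractions on each piece: every element of \<open>B\<close> is
  glued from finitely many fractions along complementary idempotents. Hence \<open>B\<close> is von Neumann
  regular, its localizations at primes are fields, and locally at a prime every element is a
  fraction of elements of \<open>R\<close>, which gives the residue field.

  For flatness, view an element of the free module on \<open>N \<times> M\<close> as a finite matrix. The relations of the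
  tensor product are spanned by matrices all of whose columns sum to zero in \<open>N\<close> and matrices all of
  whose rows sum to zero in \<open>M\<close>. If the image of \<open>z\<close> under an injection \<open>N' \<rightarrow> N\<close> is \<open>a + r\<close> of this form,
  then the rows of \<open>a\<close> outside \<open>N'\<close> sum to zero, and over a von Neumann regular ring they can be
  cleared one at a time without changing any row or column sum. What remains pulls back to \<open>N'\<close>.
\<close>

section \<open>Localization\<close>

text \<open>In B a common denominator can lose a summand: \<open>x s\<close> vanishes on the piece
  where \<open>eta s\<close> does, so \<open>eta a x s + eta b x t\<close> agrees with (a t + b
  s)/(s t) only where both denominators are invertible. Normal forms are therefore fractions on
  pieces. A prime contains exactly one member of each complementary pair of idempotents, so
  localizing follows one branch of the gluing and reaches a single fraction. For flatness, the
  obstacle is that a relation in N (x) M may pass through elements of N outside N'. Splitting it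
  into a zero-column and a zero-row part makes this visible as finitely many rows off the image of
  N'. Such a row c sums to zero in M, so multiples of c can be added to other rows without changing
  any row sum. Clearing the row c itself in this way, with multipliers that combine the columns of
  the matrix, requires a combination of the entries of c that acts as the identity on all of them.
  Regularity supplies it, because finitely generated ideals are then generated by
  idempotents.\<close>

lemma UN_UN_eqI:
  assumes "U \<noteq> {}" "V \<noteq> {}" "\<And>x y. x \<in> U \<Longrightarrow> y \<in> V \<Longrightarrow> F x y = C"
  shows "(\<Union>x\<in>U. \<Union>y\<in>V. F x y) = C"
  using assms by blast

locale mult_submonoid = cring A for A (structure) + fixes S
  assumes S_sub: "S \<subseteq> carrier A" and S_one: "\<one> \<in> S"
    and S_mult: "s \<in> S \<Longrightarrow> t \<in> S \<Longrightarrow> s \<otimes> t \<in> S"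
begin

lemma S_carr: "s \<in> S \<Longrightarrow> s \<in> carrier A"
  using S_sub by auto

lemma loc_rel_iff:
  "((a, s), (b, t)) \<in> loc_rel A S \<longleftrightarrow>
     a \<in> carrier A \<and> b \<in> carrier A \<and> s \<in> S \<and> t \<in> S \<and> (\<exists>u\<in>S. u \<otimes> (a \<otimes> t) = u \<otimes> (b \<otimes> s))"
proof -
  have "u \<otimes> (a \<otimes> t \<ominus> b \<otimes> s) = \<zero> \<longleftrightarrow> u \<otimes> (a \<otimes> t) = u \<otimes> (b \<otimes> s)"
    if "a \<in> carrier A" "b \<in> carrier A" "s \<in> S" "t \<in> S" "u \<in> S" for u
  proof -
    have "u \<otimes> (a \<otimes> t \<ominus> b \<otimes> s) = u \<otimes> (a \<otimes> t) \<ominus> u \<otimes> (b \<otimes> s)"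
      using that S_carr by (simp add: a_minus_def r_distr r_minus)
    then show ?thesis
      using that S_carr by (simp add: r_right_minus_eq)
  qed
  then show ?thesis
    unfolding loc_rel_def by auto
qed

lemma loc_rel_trans:
  assumes "((a, s), (b, t)) \<in> loc_rel A S" "((b, t), (c, w)) \<in> loc_rel A S"
  shows "((a, s), (c, w)) \<in> loc_rel A S"
proof -
  from assms obtain u v where
    carr: "a \<in> carrier A" "b \<in> carrier A" "c \<in> carrier A" "s \<in> S" "t \<in> S" "w \<in> S" "u \<in> S" "v \<in> S"
    and eq: "u \<otimes> (a \<otimes> t) = u \<otimes> (b \<otimes> s)" "v \<otimes> (b \<otimes> w) = v \<otimes> (c \<otimes> t)"
    unfolding loc_rel_iff by blast
  note carr' = carr(1-3) carr(4-8)[THEN S_carr]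
  \<comment> \<open>The middle denominator t cannot be cancelled, so it joins the two given
    multipliers in the new one.\<close>
  have "(u \<otimes> v \<otimes> t) \<otimes> (a \<otimes> w) = (v \<otimes> w) \<otimes> (u \<otimes> (a \<otimes> t))"
    using carr' by (simp add: m_ac)
  also have "\<dots> = (u \<otimes> s) \<otimes> (v \<otimes> (b \<otimes> w))"
    unfolding eq(1) using carr' by (simp add: m_ac)
  also have "\<dots> = (u \<otimes> v \<otimes> t) \<otimes> (c \<otimes> s)"
    unfolding eq(2) using carr' by (simp add: m_ac)
  finally show ?thesis
    unfolding loc_rel_iff using carr S_mult by blast
qed

lemma loc_rel_equiv: "equiv (carrier A \<times> S) (loc_rel A S)"
proof (rule equivI)
  show "loc_rel A S \<subseteq> (carrier A \<times> S) \<times> carrier A \<times> S"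
    by (auto simp: loc_rel_def)
  show "refl_on (carrier A \<times> S) (loc_rel A S)"
    by (rule refl_onI) (auto simp: loc_rel_iff intro: S_one)
  show "sym (loc_rel A S)"
    by (rule symI) (force simp: loc_rel_iff)
  show "trans (loc_rel A S)"
    by (rule transI) (use loc_rel_trans in auto)
qed

lemma loc_class_eq_iff:
  assumes "a \<in> carrier A" "b \<in> carrier A" "s \<in> S" "t \<in> S"
  shows "loc_class A S a s = loc_class A S b t \<longleftrightarrow> (\<exists>u\<in>S. u \<otimes> (a \<otimes> t) = u \<otimes> (b \<otimes> s))"
  unfolding loc_class_def
  using eq_equiv_class_iff[OF loc_rel_equiv, of "(a, s)" "(b, t)"] assms
  by (simp add: loc_rel_iff)

lemma loc_class_eqI:
  assumes "a \<in> carrier A" "b \<in> carrier A" "s \<in> S" "t \<in> S" "a \<otimes> t = b \<otimes> s"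
  shows "loc_class A S a s = loc_class A S b t"
  using assms loc_class_eq_iff S_one by auto

lemma loc_class_self: "a \<in> carrier A \<Longrightarrow> s \<in> S \<Longrightarrow> (a, s) \<in> loc_class A S a s"
  unfolding loc_class_def using loc_rel_iff S_one by auto

lemma loc_class_memD:
  assumes "(b, t) \<in> loc_class A S a s"
  shows "b \<in> carrier A" "t \<in> S" "loc_class A S b t = loc_class A S a s"
proof -
  have r: "((a, s), (b, t)) \<in> loc_rel A S"
    using assms by (simp add: loc_class_def)
  then show "b \<in> carrier A" "t \<in> S"
    by (auto simp: loc_rel_iff)
  show "loc_class A S b t = loc_class A S a s"
    unfolding loc_class_def using equiv_class_eq[OF loc_rel_equiv r] by simp
qed

lemma carrier_Localization: "carrier (Localization A S) = {loc_class A S a s | a s. a \<in> carrier A \<and> s \<in> S}"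
  by (auto simp: Localization_def quotient_def loc_class_def)

lemma Localization_cases:
  assumes "U \<in> carrier (Localization A S)"
  obtains a s where "a \<in> carrier A" "s \<in> S" "U = loc_class A S a s"
  using assms by (auto simp: carrier_Localization)

lemma loc_class_closed: "a \<in> carrier A \<Longrightarrow> s \<in> S \<Longrightarrow> loc_class A S a s \<in> carrier (Localization A S)"
  by (auto simp: carrier_Localization)

text \<open>The product of classes is a union over all pairs of representatives. It collapses to one
  class because every pair yields the same one: multipliers u and v for the two factors give the
  multiplier u v for the product.\<close>

lemma mult_loc_class:
  assumes "a \<in> carrier A" "b \<in> carrier A" "s \<in> S" "t \<in> S"
  shows "loc_class A S a s \<otimes>\<^bsub>Localization A S\<^esub> loc_class A S b t = loc_class A S (a \<otimes> b) (s \<otimes> t)"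
proof -
  have "loc_class A S (a' \<otimes> b') (s' \<otimes> t') = loc_class A S (a \<otimes> b) (s \<otimes> t)"
    if x: "(a', s') \<in> loc_class A S a s" and y: "(b', t') \<in> loc_class A S b t" for a' s' b' t'
  proof -
    note carr = assms loc_class_memD(1,2)[OF x] loc_class_memD(1,2)[OF y]
    obtain u where u: "u \<in> S" "u \<otimes> (a' \<otimes> s) = u \<otimes> (a \<otimes> s')"
      using loc_class_memD(3)[OF x] carr loc_class_eq_iff by auto
    obtain v where v: "v \<in> S" "v \<otimes> (b' \<otimes> t) = v \<otimes> (b \<otimes> t')"
      using loc_class_memD(3)[OF y] carr loc_class_eq_iff by auto
    note c = carr S_carr u(1) v(1)
    have "(u \<otimes> v) \<otimes> ((a' \<otimes> b') \<otimes> (s \<otimes> t)) = (u \<otimes> (a' \<otimes> s)) \<otimes> (v \<otimes> (b' \<otimes> t))"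
      using c by (simp add: m_ac)
    also have "\<dots> = (u \<otimes> v) \<otimes> ((a \<otimes> b) \<otimes> (s' \<otimes> t'))"
      unfolding u(2) v(2) using c by (simp add: m_ac)
    finally show ?thesis
      using c S_mult by (subst loc_class_eq_iff) auto
  qed
  note wd = this
  have "loc_mult A S (loc_class A S a s) (loc_class A S b t) = loc_class A S (a \<otimes> b) (s \<otimes> t)"
    unfolding loc_mult_def
  proof (rule UN_UN_eqI)
    show "loc_class A S a s \<noteq> {}" "loc_class A S b t \<noteq> {}"
      using loc_class_self assms by blast+
  qed (rule wd, simp_all)
  then show ?thesis
    by (simp add: Localization_def)
qed

text \<open>Independence of representatives again uses the product of the two multipliers; each
  summand needs only one of them and carries the other along.\<close>

lemma add_loc_class:
  assumes "a \<in> carrier A" "b \<in> carrier A" "s \<in> S" "t \<in> S"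
  shows "loc_class A S a s \<oplus>\<^bsub>Localization A S\<^esub> loc_class A S b t =
    loc_class A S (a \<otimes> t \<oplus> b \<otimes> s) (s \<otimes> t)"
proof -
  have "loc_class A S (a' \<otimes> t' \<oplus> b' \<otimes> s') (s' \<otimes> t') = loc_class A S (a \<otimes> t \<oplus> b \<otimes> s) (s \<otimes> t)"
    if x: "(a', s') \<in> loc_class A S a s" and y: "(b', t') \<in> loc_class A S b t" for a' s' b' t'
  proof -
    note carr = assms loc_class_memD(1,2)[OF x] loc_class_memD(1,2)[OF y]
    obtain u where u: "u \<in> S" "u \<otimes> (a' \<otimes> s) = u \<otimes> (a \<otimes> s')"
      using loc_class_memD(3)[OF x] carr loc_class_eq_iff by auto
    obtain v where v: "v \<in> S" "v \<otimes> (b' \<otimes> t) = v \<otimes> (b \<otimes> t')"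
      using loc_class_memD(3)[OF y] carr loc_class_eq_iff by auto
    note c = carr S_carr u(1) v(1)
    have "(u \<otimes> v) \<otimes> ((a' \<otimes> t' \<oplus> b' \<otimes> s') \<otimes> (s \<otimes> t))
        = (v \<otimes> t \<otimes> t') \<otimes> (u \<otimes> (a' \<otimes> s)) \<oplus> (u \<otimes> s \<otimes> s') \<otimes> (v \<otimes> (b' \<otimes> t))"
      using c by (simp add: m_ac r_distr l_distr)
    also have "\<dots> = (u \<otimes> v) \<otimes> ((a \<otimes> t \<oplus> b \<otimes> s) \<otimes> (s' \<otimes> t'))"
      unfolding u(2) v(2) using c by (simp add: m_ac r_distr l_distr)
    finally show ?thesis
      using c S_mult by (subst loc_class_eq_iff) auto
  qed
  note wd = this
  have "loc_add A S (loc_class A S a s) (loc_class A S b t) = loc_class A S (a \<otimes> t \<oplus> b \<otimes> s) (s \<otimes> t)"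
    unfolding loc_add_def
  proof (rule UN_UN_eqI)
    show "loc_class A S a s \<noteq> {}" "loc_class A S b t \<noteq> {}"
      using loc_class_self assms by blast+
  qed (rule wd, simp_all)
  then show ?thesis
    by (simp add: Localization_def)
qed

lemma one_Localization: "\<one>\<^bsub>Localization A S\<^esub> = loc_class A S \<one> \<one>"
  and zero_Localization: "\<zero>\<^bsub>Localization A S\<^esub> = loc_class A S \<zero> \<one>"
  by (simp_all add: Localization_def)

lemma loc_class_eq_zero_iff:
  assumes "a \<in> carrier A" "s \<in> S"
  shows "loc_class A S a s = \<zero>\<^bsub>Localization A S\<^esub> \<longleftrightarrow> (\<exists>u\<in>S. u \<otimes> a = \<zero>)"
  unfolding zero_Localization using assms S_one S_carr by (subst loc_class_eq_iff) auto

lemma Localization_cring: "cring (Localization A S)"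
proof (rule cringI)
  show "abelian_group (Localization A S)"
  proof (rule abelian_groupI)
    fix U assume "U \<in> carrier (Localization A S)"
    then obtain a s where U: "a \<in> carrier A" "s \<in> S" "U = loc_class A S a s"
      by (rule Localization_cases)
    show "\<zero>\<^bsub>Localization A S\<^esub> \<oplus>\<^bsub>Localization A S\<^esub> U = U"
      using U S_one S_carr by (simp add: zero_Localization add_loc_class)
    have "loc_class A S (\<ominus> a) s \<oplus>\<^bsub>Localization A S\<^esub> U = \<zero>\<^bsub>Localization A S\<^esub>"
      unfolding U(3) zero_Localization using U(1,2) S_one S_carr S_mult
      by (subst add_loc_class; (simp add: l_minus l_neg)?) (rule loc_class_eqI; simp)
    then show "\<exists>V\<in>carrier (Localization A S). V \<oplus>\<^bsub>Localization A S\<^esub> U = \<zero>\<^bsub>Localization A S\<^esub>"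
      using U loc_class_closed by blast
  next
    fix U V assume UVW: "U \<in> carrier (Localization A S)" "V \<in> carrier (Localization A S)"
    obtain a s where U: "a \<in> carrier A" "s \<in> S" "U = loc_class A S a s"
      using UVW(1) by (rule Localization_cases)
    obtain b t where V: "b \<in> carrier A" "t \<in> S" "V = loc_class A S b t"
      using UVW(2) by (rule Localization_cases)
    note carr = U(1,2) S_carr[OF U(2)] V(1,2) S_carr[OF V(2)]
    note eqs = U(3) V(3)
    show "U \<oplus>\<^bsub>Localization A S\<^esub> V \<in> carrier (Localization A S)"
      unfolding eqs using carr by (simp add: add_loc_class loc_class_closed S_mult)
    show "U \<oplus>\<^bsub>Localization A S\<^esub> V = V \<oplus>\<^bsub>Localization A S\<^esub> U"
      unfolding eqs using carr by (simp add: add_loc_class m_comm a_comm)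
  next
    fix U V W assume UVW: "U \<in> carrier (Localization A S)" "V \<in> carrier (Localization A S)" "W \<in> carrier (Localization A S)"
    obtain a s where U: "a \<in> carrier A" "s \<in> S" "U = loc_class A S a s"
      using UVW(1) by (rule Localization_cases)
    obtain b t where V: "b \<in> carrier A" "t \<in> S" "V = loc_class A S b t"
      using UVW(2) by (rule Localization_cases)
    obtain c w where W: "c \<in> carrier A" "w \<in> S" "W = loc_class A S c w"
      using UVW(3) by (rule Localization_cases)
    note carr = U(1,2) S_carr[OF U(2)] V(1,2) S_carr[OF V(2)] W(1,2) S_carr[OF W(2)]
    note eqs = U(3) V(3) W(3)
    show "U \<oplus>\<^bsub>Localization A S\<^esub> V \<oplus>\<^bsub>Localization A S\<^esub> W = U \<oplus>\<^bsub>Localization A S\<^esub> (V \<oplus>\<^bsub>Localization A S\<^esub> W)"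
      unfolding eqs using carr by (simp add: add_loc_class S_mult m_ac a_ac l_distr r_distr)
  next
    show "\<zero>\<^bsub>Localization A S\<^esub> \<in> carrier (Localization A S)"
      by (simp add: zero_Localization loc_class_closed S_one)
  qed
  show "Group.comm_monoid (Localization A S)"
  proof (rule comm_monoidI)
    fix U V assume UVW: "U \<in> carrier (Localization A S)" "V \<in> carrier (Localization A S)"
    obtain a s where U: "a \<in> carrier A" "s \<in> S" "U = loc_class A S a s"
      using UVW(1) by (rule Localization_cases)
    obtain b t where V: "b \<in> carrier A" "t \<in> S" "V = loc_class A S b t"
      using UVW(2) by (rule Localization_cases)
    note carr = U(1,2) S_carr[OF U(2)] V(1,2) S_carr[OF V(2)]
    note eqs = U(3) V(3)
    show "U \<otimes>\<^bsub>Localization A S\<^esub> V \<in> carrier (Localization A S)"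
      unfolding eqs using carr by (simp add: mult_loc_class loc_class_closed S_mult)
    show "U \<otimes>\<^bsub>Localization A S\<^esub> V = V \<otimes>\<^bsub>Localization A S\<^esub> U"
      unfolding eqs using carr by (simp add: mult_loc_class m_comm)
  next
    fix U V W assume UVW: "U \<in> carrier (Localization A S)" "V \<in> carrier (Localization A S)" "W \<in> carrier (Localization A S)"
    obtain a s where U: "a \<in> carrier A" "s \<in> S" "U = loc_class A S a s"
      using UVW(1) by (rule Localization_cases)
    obtain b t where V: "b \<in> carrier A" "t \<in> S" "V = loc_class A S b t"
      using UVW(2) by (rule Localization_cases)
    obtain c w where W: "c \<in> carrier A" "w \<in> S" "W = loc_class A S c w"
      using UVW(3) by (rule Localization_cases)
    note carr = U(1,2) S_carr[OF U(2)] V(1,2) S_carr[OF V(2)] W(1,2) S_carr[OF W(2)]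
    note eqs = U(3) V(3) W(3)
    show "U \<otimes>\<^bsub>Localization A S\<^esub> V \<otimes>\<^bsub>Localization A S\<^esub> W = U \<otimes>\<^bsub>Localization A S\<^esub> (V \<otimes>\<^bsub>Localization A S\<^esub> W)"
      unfolding eqs using carr by (simp add: mult_loc_class S_mult m_ac)
  next
    fix U assume UVW: "U \<in> carrier (Localization A S)"
    obtain a s where U: "a \<in> carrier A" "s \<in> S" "U = loc_class A S a s"
      using UVW(1) by (rule Localization_cases)
    note carr = U(1,2) S_carr[OF U(2)]
    note eqs = U(3)
    show "\<one>\<^bsub>Localization A S\<^esub> \<otimes>\<^bsub>Localization A S\<^esub> U = U"
      unfolding eqs one_Localization using carr by (simp add: mult_loc_class S_one)
  next
    show "\<one>\<^bsub>Localization A S\<^esub> \<in> carrier (Localization A S)"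
      by (simp add: one_Localization loc_class_closed S_one)
  qed
  fix U V W assume UVW: "U \<in> carrier (Localization A S)" "V \<in> carrier (Localization A S)" "W \<in> carrier (Localization A S)"
  obtain a s where U: "a \<in> carrier A" "s \<in> S" "U = loc_class A S a s"
    using UVW(1) by (rule Localization_cases)
  obtain b t where V: "b \<in> carrier A" "t \<in> S" "V = loc_class A S b t"
    using UVW(2) by (rule Localization_cases)
  obtain c w where W: "c \<in> carrier A" "w \<in> S" "W = loc_class A S c w"
    using UVW(3) by (rule Localization_cases)
  note carr = U(1,2) S_carr[OF U(2)] V(1,2) S_carr[OF V(2)] W(1,2) S_carr[OF W(2)]
  note eqs = U(3) V(3) W(3)
  have "loc_class A S ((a \<otimes> t \<oplus> b \<otimes> s) \<otimes> c) (s \<otimes> t \<otimes> w) =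
      loc_class A S ((a \<otimes> c) \<otimes> (t \<otimes> w) \<oplus> (b \<otimes> c) \<otimes> (s \<otimes> w)) ((s \<otimes> w) \<otimes> (t \<otimes> w))"
    using carr S_mult by (intro loc_class_eqI) (simp_all add: m_ac l_distr r_distr)
  then show "(U \<oplus>\<^bsub>Localization A S\<^esub> V) \<otimes>\<^bsub>Localization A S\<^esub> W = U \<otimes>\<^bsub>Localization A S\<^esub> W \<oplus>\<^bsub>Localization A S\<^esub> V \<otimes>\<^bsub>Localization A S\<^esub> W"
    unfolding eqs using carr by (simp add: add_loc_class mult_loc_class S_mult)
qed

end

lemma (in primeideal) mult_submonoid_compl: "mult_submonoid R (carrier R - I)"
proof -
  have "\<one> \<notin> I"
    using I_notcarr one_imp_carrier by blast
  then show ?thesis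
    by unfold_locales (use I_prime in auto)
qed

section \<open>Von Neumann regular rings and pointwise inverses\<close>

lemma type_ring_simps [simp]:
  "carrier type_ring = UNIV" "\<one>\<^bsub>type_ring\<^esub> = 1" "\<zero>\<^bsub>type_ring\<^esub> = 0"
  "a \<otimes>\<^bsub>type_ring\<^esub> b = a * b" "a \<oplus>\<^bsub>type_ring\<^esub> b = a + b"
  by (simp_all add: type_ring_def)

lemma type_ring_cring: "cring (type_ring :: 'a::comm_ring_1 ring)"
proof (rule cringI)
  show "abelian_group (type_ring :: 'a ring)"
    by (rule abelian_groupI) (auto simp: algebra_simps intro: exI[of _ "- _"])
  show "Group.comm_monoid (type_ring :: 'a ring)"
    by (rule comm_monoidI) (auto simp: algebra_simps)
qed (simp add: algebra_simps)

lemma type_ring_minus [simp]: "a \<ominus>\<^bsub>type_ring\<^esub> b = a - b"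
proof -
  interpret T: cring "type_ring :: 'a ring" by (rule type_ring_cring)
  have "\<ominus>\<^bsub>type_ring\<^esub> b = - b"
    using T.minus_equality[of "- b" b] by simp
  then show ?thesis
    by (simp add: a_minus_def)
qed

definition von_neumann_regular :: "('b, 'c) ring_scheme \<Rightarrow> bool" where
  "von_neumann_regular B \<longleftrightarrow> (\<forall>b\<in>carrier B. \<exists>y\<in>carrier B. b \<otimes>\<^bsub>B\<^esub> b \<otimes>\<^bsub>B\<^esub> y = b)"

text \<open>A decomposition of the ring into a product of two factors. Idempotence of both elements
  follows from sum one and product zero.\<close>

definition compl_idem :: "('b, 'c) ring_scheme \<Rightarrow> 'b \<Rightarrow> 'b \<Rightarrow> bool" where
  "compl_idem B e e' \<longleftrightarrow> e \<in> carrier B \<and> e' \<in> carrier B \<and>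
     e \<oplus>\<^bsub>B\<^esub> e' = \<one>\<^bsub>B\<^esub> \<and> e \<otimes>\<^bsub>B\<^esub> e' = \<zero>\<^bsub>B\<^esub>"

section \<open>Splitting a ring along complementary idempotents\<close>

context cring
begin

lemma compl_idemD:
  assumes "compl_idem R e e'"
  shows "e \<in> carrier R" "e' \<in> carrier R" "e \<oplus> e' = \<one>" "e \<otimes> e' = \<zero>" "e' \<otimes> e = \<zero>"
    "e \<otimes> e = e" "e' \<otimes> e' = e'"
proof -
  show c: "e \<in> carrier R" "e' \<in> carrier R" and s: "e \<oplus> e' = \<one>" and z: "e \<otimes> e' = \<zero>"
    using assms by (auto simp: compl_idem_def)
  show z': "e' \<otimes> e = \<zero>"
    using c z m_comm by simp
  have "e \<otimes> (e \<oplus> e') = e" "e' \<otimes> (e \<oplus> e') = e'"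
    using c s by simp_all
  then show "e \<otimes> e = e" "e' \<otimes> e' = e'"
    using c z z' by (simp_all add: r_distr)
qed

lemma compl_idemI:
  assumes "e \<in> carrier R" "e \<otimes> e = e"
  shows "compl_idem R e (\<one> \<ominus> e)"
proof -
  have "e \<oplus> (\<one> \<ominus> e) = \<one>"
    using assms by algebra
  moreover have "e \<otimes> (\<one> \<ominus> e) = \<zero>"
    using assms by (simp add: a_minus_def r_distr r_minus r_neg)
  ultimately show ?thesis
    using assms by (simp add: compl_idem_def)
qed

text \<open>On the product of the two pieces multiplication is componentwise: the mixed terms
  contain \<open>e e' = 0\<close>.\<close>

lemma glue_mult:
  assumes e: "compl_idem R e e'"
    and c: "b \<in> carrier R" "c \<in> carrier R" "d \<in> carrier R" "g \<in> carrier R"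
  shows "(e \<otimes> b \<oplus> e' \<otimes> c) \<otimes> (e \<otimes> d \<oplus> e' \<otimes> g) = e \<otimes> (b \<otimes> d) \<oplus> e' \<otimes> (c \<otimes> g)"
proof -
  note E = compl_idemD[OF e]
  have "(e \<otimes> b \<oplus> e' \<otimes> c) \<otimes> (e \<otimes> d \<oplus> e' \<otimes> g) = (e \<otimes> e) \<otimes> (b \<otimes> d) \<oplus> (e \<otimes> e') \<otimes> (b \<otimes> g)
      \<oplus> (e' \<otimes> e) \<otimes> (c \<otimes> d) \<oplus> (e' \<otimes> e') \<otimes> (c \<otimes> g)"
    using E(1,2) c by algebra
  then show ?thesis
    using E c by simp
qed

lemma split_compl_idem:
  assumes e: "compl_idem R e e'" and b: "b \<in> carrier R"
  shows "b = e \<otimes> b \<oplus> e' \<otimes> b"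
  using compl_idemD[OF e] b by (simp flip: l_distr)

lemma split_compl_idem_eqI:
  assumes e: "compl_idem R e e'" and c: "b \<in> carrier R" "c \<in> carrier R" "d \<in> carrier R"
    and eq: "e \<otimes> b = e \<otimes> c" "e' \<otimes> b = e' \<otimes> d"
  shows "b = e \<otimes> c \<oplus> e' \<otimes> d"
  using split_compl_idem[OF e c(1)] unfolding eq .

text \<open>Both \<open>a^2 y\<close> and \<open>a^2 z\<close> equal \<open>a\<close>. Exchanging
  one for the other turns \<open>a y^2\<close> into \<open>a y z\<close> and then into
  \<open>a z^2\<close>.\<close>

lemma pointwise_inverse_unique:
  assumes c: "a \<in> carrier R" "y \<in> carrier R" "z \<in> carrier R"
    and y: "a \<otimes> (y \<otimes> y) = y" "a \<otimes> a \<otimes> y = a"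
    and z: "a \<otimes> (z \<otimes> z) = z" "a \<otimes> a \<otimes> z = a"
  shows "y = z"
proof -
  have "y = (a \<otimes> a \<otimes> z) \<otimes> (y \<otimes> y)"
    using y(1) z(2) by simp
  also have "\<dots> = (a \<otimes> a \<otimes> y) \<otimes> (y \<otimes> z)"
    using c by (simp add: m_ac)
  also have "\<dots> = (a \<otimes> a \<otimes> z) \<otimes> (y \<otimes> z)"
    unfolding y(2) z(2) ..
  also have "\<dots> = (a \<otimes> a \<otimes> y) \<otimes> (z \<otimes> z)"
    using c by (simp add: m_ac)
  also have "\<dots> = z"
    using z(1) y(2) by simp
  finally show ?thesis .
qed

text \<open>A fraction whose numerator lies in the prime is zero, and any other fraction is inverted
  by flipping it. The criterion for zero is recorded separately because it later identifies the
  kernel of the map to the localization.\<close>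

lemma vnr_loc_at_field:
  assumes vnr: "von_neumann_regular R" and q: "primeideal q R"
  shows "field (loc_at R q)"
    and "\<And>b s. b \<in> carrier R \<Longrightarrow> s \<in> carrier R - q \<Longrightarrow>
      loc_class R (carrier R - q) b s = \<zero>\<^bsub>loc_at R q\<^esub> \<longleftrightarrow> b \<in> q"
proof -
  interpret q: primeideal q R by fact
  interpret S: mult_submonoid R "carrier R - q" by (rule q.mult_submonoid_compl)
  let ?L = "Localization R (carrier R - q)"
  let ?c = "loc_class R (carrier R - q)"
  show z: "?c b s = \<zero>\<^bsub>loc_at R q\<^esub> \<longleftrightarrow> b \<in> q" if b: "b \<in> carrier R" "s \<in> carrier R - q" for b s
  proof
    assume "?c b s = \<zero>\<^bsub>loc_at R q\<^esub>"
    then obtain u where "u \<in> carrier R - q" "u \<otimes> b = \<zero>"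
      using S.loc_class_eq_zero_iff[OF b] by (auto simp: loc_at_def)
    then show "b \<in> q"
      using q.I_prime[of u b] b q.zero_closed by auto
  next
    assume bq: "b \<in> q"
    \<comment> \<open>Since \<open>b y\<close> lies in q, its complement \<open>1 - b y\<close> lies
      outside q, and it annihilates b because \<open>b = b^2 y\<close>.\<close>
    obtain y where y: "y \<in> carrier R" "b \<otimes> b \<otimes> y = b"
      using vnr b by (auto simp: von_neumann_regular_def)
    have by_q: "b \<otimes> y \<in> q"
      using bq y q.I_r_closed by simp
    have "\<one> \<ominus> b \<otimes> y \<notin> q"
    proof
      assume "\<one> \<ominus> b \<otimes> y \<in> q"
      then have "(\<one> \<ominus> b \<otimes> y) \<oplus> b \<otimes> y \<in> q"
        using by_q q.a_closed by blast
      moreover have "(\<one> \<ominus> b \<otimes> y) \<oplus> b \<otimes> y = \<one>"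
        using b y(1) by algebra
      ultimately show False
        using S.S_one by simp
    qed
    moreover have "(\<one> \<ominus> b \<otimes> y) \<otimes> b = b \<ominus> b \<otimes> b \<otimes> y"
      using b y(1) by algebra
    ultimately show "?c b s = \<zero>\<^bsub>loc_at R q\<^esub>"
      using S.loc_class_eq_zero_iff[OF b] b y by (auto simp: loc_at_def intro!: bexI[of _ "\<one> \<ominus> b \<otimes> y"])
  qed
  interpret L: cring ?L by (rule S.Localization_cring)
  have ne: "\<one>\<^bsub>?L\<^esub> \<noteq> \<zero>\<^bsub>?L\<^esub>"
    using z[of \<one> \<one>] S.S_one by (simp add: loc_at_def S.one_Localization)
  have inv: "U \<in> Units ?L" if U: "U \<in> carrier ?L" "U \<noteq> \<zero>\<^bsub>?L\<^esub>" for U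
  proof -
    obtain b s where bs: "b \<in> carrier R" "s \<in> carrier R - q" "U = ?c b s"
      using U(1) by (rule S.Localization_cases)
    then have bq: "b \<in> carrier R - q"
      using z[of b s] U(2) by (simp add: loc_at_def)
    have "?c (s \<otimes> b) (b \<otimes> s) = ?c \<one> \<one>"
      using bs(1,2) bq S.S_mult S.S_one by (intro S.loc_class_eqI) (auto simp: m_comm)
    then have "?c s b \<otimes>\<^bsub>?L\<^esub> U = \<one>\<^bsub>?L\<^esub>"
      using bs bq by (simp add: S.mult_loc_class S.one_Localization)
    moreover have "?c s b \<in> carrier ?L"
      using bs bq by (simp add: S.loc_class_closed)
    ultimately show ?thesis
      using U(1) L.m_comm by (force simp: Units_def)
  qed
  have "Units ?L = carrier ?L - {\<zero>\<^bsub>?L\<^esub>}"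
  proof (intro equalityI subsetI)
    fix U assume U: "U \<in> Units ?L"
    have "\<zero>\<^bsub>?L\<^esub> \<notin> Units ?L"
      using L.Units_l_inv_ex[of "\<zero>\<^bsub>?L\<^esub>"] ne by auto
    then show "U \<in> carrier ?L - {\<zero>\<^bsub>?L\<^esub>}"
      using U L.Units_closed by auto
  qed (use inv in blast)
  then show "field (loc_at R q)"
    unfolding loc_at_def by (rule L.cring_fieldI)
qed

end

text \<open>What is retained of the presentation by generators and relations: the two identities of
  a pointwise inverse and generation by \<open>eta\<close> and \<open>x\<close>. Closure under sums
  and products suffices for generation, as negatives are products with
  \<open>eta (- 1)\<close>.\<close>

locale pointwise_inverse_ring = cring B for B :: "('b, 'c) ring_scheme" (structure) +
  fixes eta :: "'r::comm_ring_1 \<Rightarrow> 'b" and x :: "'r \<Rightarrow> 'b"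
  assumes eta_hom: "eta \<in> ring_hom type_ring B"
    and x_closed [simp]: "x s \<in> carrier B"
    and x_inv: "eta s \<otimes> (x s \<otimes> x s) = x s" "eta s \<otimes> eta s \<otimes> x s = eta s"
    and generated: "\<lbrakk>range eta \<subseteq> T; range x \<subseteq> T; \<And>a b. a \<in> T \<Longrightarrow> b \<in> T \<Longrightarrow> a \<oplus> b \<in> T;
      \<And>a b. a \<in> T \<Longrightarrow> b \<in> T \<Longrightarrow> a \<otimes> b \<in> T\<rbrakk> \<Longrightarrow> carrier B \<subseteq> T"
begin

section \<open>Fractions and their gluing\<close>

lemma eta_simps [simp]:
  "eta a \<in> carrier B" "eta (a * b) = eta a \<otimes> eta b" "eta (a + b) = eta a \<oplus> eta b"
  "eta 1 = \<one>" "eta 0 = \<zero>"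
proof -
  interpret T: cring "type_ring :: 'r ring" by (rule type_ring_cring)
  interpret h: ring_hom_cring type_ring B eta
    by unfold_locales (rule eta_hom)
  show "eta a \<in> carrier B" "eta (a * b) = eta a \<otimes> eta b" "eta (a + b) = eta a \<oplus> eta b"
    "eta 1 = \<one>" "eta 0 = \<zero>"
    using h.hom_closed[of a] h.hom_mult[of a b] h.hom_add[of a b] h.hom_one h.hom_zero by simp_all
qed

lemma x_mult: "x (s * t) = x s \<otimes> x t"
proof (rule pointwise_inverse_unique[of "eta (s * t)"])
  have "eta (s * t) \<otimes> ((x s \<otimes> x t) \<otimes> (x s \<otimes> x t))
      = (eta s \<otimes> (x s \<otimes> x s)) \<otimes> (eta t \<otimes> (x t \<otimes> x t))"
    by (simp add: m_ac)
  then show "eta (s * t) \<otimes> ((x s \<otimes> x t) \<otimes> (x s \<otimes> x t)) = x s \<otimes> x t"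
    by (simp only: x_inv)
  have "eta (s * t) \<otimes> eta (s * t) \<otimes> (x s \<otimes> x t)
      = (eta s \<otimes> eta s \<otimes> x s) \<otimes> (eta t \<otimes> eta t \<otimes> x t)"
    by (simp add: m_ac)
  then show "eta (s * t) \<otimes> eta (s * t) \<otimes> (x s \<otimes> x t) = eta (s * t)"
    by (simp only: x_inv eta_simps)
qed (simp_all only: x_inv, simp_all)

lemma x_one: "x 1 = \<one>"
  using x_inv(2)[of 1] by simp

lemma eta_x_idem: "(eta s \<otimes> x s) \<otimes> (eta s \<otimes> x s) = eta s \<otimes> x s"
proof -
  have "(eta s \<otimes> x s) \<otimes> (eta s \<otimes> x s) = (eta s \<otimes> eta s \<otimes> x s) \<otimes> x s"
    by (simp add: m_ac)
  then show ?thesis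
    by (simp only: x_inv)
qed

lemma eta_x_compl: "compl_idem B (eta s \<otimes> x s) (\<one> \<ominus> eta s \<otimes> x s)"
  by (rule compl_idemI) (simp_all add: eta_x_idem)

text \<open>On the piece where \<open>eta s\<close> is zero its pointwise inverse is zero too, so
  every fraction with denominator s disappears there.\<close>

lemma compl_mult_x: "(\<one> \<ominus> eta s \<otimes> x s) \<otimes> x s = \<zero>"
proof -
  have "(\<one> \<ominus> eta s \<otimes> x s) \<otimes> x s = x s \<ominus> eta s \<otimes> (x s \<otimes> x s)"
    using eta_simps(1)[of s] x_closed[of s] by algebra
  then show ?thesis
    by (simp add: x_inv)
qed

text \<open>Nested binary splittings stand for a finite family of orthogonal idempotents. Adding or
  multiplying by a fixed element passes through each node, so closure reduces to the leaves.\<close>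

inductive_set piecewise_fractions where
  fraction: "eta a \<otimes> x s \<in> piecewise_fractions"
| glue: "compl_idem B e e' \<Longrightarrow> b \<in> piecewise_fractions \<Longrightarrow> c \<in> piecewise_fractions \<Longrightarrow>
    e \<otimes> b \<oplus> e' \<otimes> c \<in> piecewise_fractions"

lemma piecewise_fractions_closed: "b \<in> piecewise_fractions \<Longrightarrow> b \<in> carrier B"
  by (induction rule: piecewise_fractions.induct) (auto simp: compl_idem_def)

text \<open>Three pieces suffice. On \<open>E'\<close> the first fraction vanishes, on
  \<open>E F'\<close> the second one does, and on \<open>E F\<close> both denominators are
  invertible and the usual sum over a common denominator is correct.\<close>

lemma fraction_add_fraction: "eta a \<otimes> x s \<oplus> eta b \<otimes> x t \<in> piecewise_fractions"
proof -
  let ?v = "eta a \<otimes> x s \<oplus> eta b \<otimes> x t"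
  define E where "E = eta s \<otimes> x s"
  define E' where "E' = \<one> \<ominus> E"
  define F where "F = eta t \<otimes> x t"
  define F' where "F' = \<one> \<ominus> F"
  have E: "compl_idem B E E'" and F: "compl_idem B F F'"
    unfolding E_def E'_def F_def F'_def by (rule eta_x_compl)+
  note Ec = compl_idemD(1,2)[OF E] compl_idemD(1,2)[OF F]
  have Ex: "E' \<otimes> x s = \<zero>" and Fx: "F' \<otimes> x t = \<zero>"
    unfolding E_def E'_def F_def F'_def by (rule compl_mult_x)+
  \<comment> \<open>The sum over the common denominator; each summand picks up the idempotent of the
    other denominator, so it matches the true sum only after multiplication by
    \<open>E F\<close>.\<close>
  define w where "w = eta (a * t + b * s) \<otimes> x (s * t)"
  have wD: "w \<in> piecewise_fractions"
    unfolding w_def by (rule fraction)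
  have w: "w = eta a \<otimes> x s \<otimes> F \<oplus> eta b \<otimes> x t \<otimes> E"
    unfolding w_def F_def E_def x_mult eta_simps
    by (simp add: l_distr m_assoc) (simp add: m_ac)
  note wc = piecewise_fractions_closed[OF wD]
  have Ev: "E' \<otimes> ?v = E' \<otimes> (eta b \<otimes> x t)"
  proof -
    have "E' \<otimes> ?v = eta a \<otimes> (E' \<otimes> x s) \<oplus> E' \<otimes> (eta b \<otimes> x t)"
      using Ec by (simp add: r_distr m_ac)
    then show ?thesis
      using Ec by (simp add: Ex)
  qed
  have Fv: "F' \<otimes> (E \<otimes> ?v) = F' \<otimes> (E \<otimes> (eta a \<otimes> x s))"
  proof -
    have "F' \<otimes> (E \<otimes> ?v) = F' \<otimes> (E \<otimes> (eta a \<otimes> x s)) \<oplus> E \<otimes> eta b \<otimes> (F' \<otimes> x t)"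
      using Ec by (simp add: r_distr m_ac)
    then show ?thesis
      using Ec by (simp add: Fx)
  qed
  have EF: "F \<otimes> (E \<otimes> ?v) = F \<otimes> (E \<otimes> w)"
  proof -
    have "F \<otimes> (E \<otimes> w) = (F \<otimes> F) \<otimes> E \<otimes> (eta a \<otimes> x s) \<oplus> F \<otimes> (E \<otimes> E) \<otimes> (eta b \<otimes> x t)"
      unfolding w using Ec by (simp add: r_distr m_ac)
    also have "\<dots> = F \<otimes> (E \<otimes> ?v)"
      unfolding compl_idemD(6)[OF E] compl_idemD(6)[OF F]
      using Ec by (simp add: r_distr m_ac)
    finally show ?thesis ..
  qed
  have "E \<otimes> ?v = F \<otimes> (E \<otimes> w) \<oplus> F' \<otimes> (E \<otimes> (eta a \<otimes> x s))"
    using EF Fv Ec wc by (intro split_compl_idem_eqI[OF F]) auto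
  also have "\<dots> = E \<otimes> (F \<otimes> w \<oplus> F' \<otimes> (eta a \<otimes> x s))"
    using Ec wc by (simp add: r_distr m_ac)
  finally have "?v = E \<otimes> (F \<otimes> w \<oplus> F' \<otimes> (eta a \<otimes> x s)) \<oplus> E' \<otimes> (eta b \<otimes> x t)"
    using Ev Ec wc by (intro split_compl_idem_eqI[OF E]) auto
  then show ?thesis
    using glue[OF E glue[OF F wD fraction[of a s]] fraction[of b t]] by simp
qed

lemma glue_add_left:
  assumes "compl_idem B e e'" "b \<in> carrier B" "c \<in> carrier B" "d \<in> carrier B"
  shows "(e \<otimes> b \<oplus> e' \<otimes> c) \<oplus> d = e \<otimes> (b \<oplus> d) \<oplus> e' \<otimes> (c \<oplus> d)"
proof -
  note E = compl_idemD(1,2)[OF assms(1)]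
  have "(e \<otimes> b \<oplus> e' \<otimes> c) \<oplus> (e \<otimes> d \<oplus> e' \<otimes> d) = e \<otimes> (b \<oplus> d) \<oplus> e' \<otimes> (c \<oplus> d)"
    using E assms by (simp add: r_distr a_ac)
  then show ?thesis
    using split_compl_idem[OF assms(1,4)] by simp
qed

lemma glue_mult_left:
  assumes "compl_idem B e e'" "b \<in> carrier B" "c \<in> carrier B" "d \<in> carrier B"
  shows "(e \<otimes> b \<oplus> e' \<otimes> c) \<otimes> d = e \<otimes> (b \<otimes> d) \<oplus> e' \<otimes> (c \<otimes> d)"
  using compl_idemD(1,2)[OF assms(1)] assms by (simp add: l_distr m_assoc)

lemma piecewise_fractions_add:
  assumes "b \<in> piecewise_fractions" "c \<in> piecewise_fractions"
  shows "b \<oplus> c \<in> piecewise_fractions"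
  using assms(1)
proof induction
  case (fraction a s)
  show ?case
    using assms(2)
  proof induction
    case (fraction b t)
    show ?case by (rule fraction_add_fraction)
  next
    case (glue e e' b c)
    then have bc: "b \<in> carrier B" "c \<in> carrier B"
      by (simp_all add: piecewise_fractions_closed)
    have "eta a \<otimes> x s \<oplus> (e \<otimes> b \<oplus> e' \<otimes> c) = e \<otimes> (eta a \<otimes> x s \<oplus> b) \<oplus> e' \<otimes> (eta a \<otimes> x s \<oplus> c)"
      using glue_add_left[OF glue(1) bc, of "eta a \<otimes> x s"] bc
        compl_idemD(1,2)[OF glue(1)] by (simp add: a_comm[of "eta a \<otimes> x s"])
    then show ?case
      using piecewise_fractions.glue[OF glue(1) glue.IH] by simp
  qed
next
  case (glue e e' b c')
  then show ?case
    using glue_add_left[OF glue(1), of b c' c] piecewise_fractions_closed assms(2)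
      piecewise_fractions.glue[OF glue(1) glue.IH] by simp
qed

lemma piecewise_fractions_mult:
  assumes "b \<in> piecewise_fractions" "c \<in> piecewise_fractions"
  shows "b \<otimes> c \<in> piecewise_fractions"
  using assms(1)
proof induction
  case (fraction a s)
  show ?case
    using assms(2)
  proof induction
    case (fraction b t)
    have "(eta a \<otimes> x s) \<otimes> (eta b \<otimes> x t) = eta (a * b) \<otimes> x (s * t)"
      by (simp add: x_mult m_ac)
    then show ?case
      by (simp only: piecewise_fractions.fraction)
  next
    case (glue e e' b c)
    then have bc: "b \<in> carrier B" "c \<in> carrier B"
      by (simp_all add: piecewise_fractions_closed)
    have "(eta a \<otimes> x s) \<otimes> (e \<otimes> b \<oplus> e' \<otimes> c) = e \<otimes> ((eta a \<otimes> x s) \<otimes> b) \<oplus> e' \<otimes> ((eta a \<otimes> x s) \<otimes> c)"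
      using glue_mult_left[OF glue(1) bc, of "eta a \<otimes> x s"] bc
        compl_idemD(1,2)[OF glue(1)] by (simp add: m_comm[of "eta a \<otimes> x s"])
    then show ?case
      using piecewise_fractions.glue[OF glue(1) glue.IH] by simp
  qed
next
  case (glue e e' b c')
  then show ?case
    using glue_mult_left[OF glue(1), of b c' c] piecewise_fractions_closed assms(2)
      piecewise_fractions.glue[OF glue(1) glue.IH] by simp
qed

lemma carrier_eq_piecewise_fractions: "carrier B = piecewise_fractions"
proof
  show "carrier B \<subseteq> piecewise_fractions"
  proof (rule generated)
    show "range eta \<subseteq> piecewise_fractions"
      using fraction[of _ 1] by (auto simp: x_one)
    show "range x \<subseteq> piecewise_fractions"
      using fraction[of 1] by auto
  qed (rule piecewise_fractions_add piecewise_fractions_mult; assumption)+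
qed (use piecewise_fractions_closed in auto)

text \<open>For a fraction the flipped fraction \<open>x a eta s\<close> is a witness; for a glued
  element the witnesses of the two pieces are glued along the same idempotents.\<close>

lemma regular: "von_neumann_regular B"
proof -
  have "\<exists>y\<in>carrier B. b \<otimes> b \<otimes> y = b" if "b \<in> piecewise_fractions" for b
    using that
  proof induction
    case (fraction a s)
    have "(eta a \<otimes> x s) \<otimes> (eta a \<otimes> x s) \<otimes> (x a \<otimes> eta s)
        = (eta a \<otimes> eta a \<otimes> x a) \<otimes> (eta s \<otimes> (x s \<otimes> x s))"
      by (simp add: m_ac)
    then show ?case
      unfolding x_inv by (intro bexI[of _ "x a \<otimes> eta s"]) simp_all
  next
    case (glue e e' b c)
    from glue.IH obtain y z where y: "y \<in> carrier B" "b \<otimes> b \<otimes> y = b"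
      and z: "z \<in> carrier B" "c \<otimes> c \<otimes> z = c" by blast
    show ?case
    proof
      show "(e \<otimes> b \<oplus> e' \<otimes> c) \<otimes> (e \<otimes> b \<oplus> e' \<otimes> c) \<otimes> (e \<otimes> y \<oplus> e' \<otimes> z) = e \<otimes> b \<oplus> e' \<otimes> c"
        using glue(1-3) y z piecewise_fractions_closed by (simp add: glue_mult)
      show "e \<otimes> y \<oplus> e' \<otimes> z \<in> carrier B"
        using y z compl_idemD(1,2)[OF glue(1)] by simp
    qed
  qed
  then show ?thesis
    by (simp add: von_neumann_regular_def carrier_eq_piecewise_fractions)
qed

text \<open>Of two complementary idempotents at least one lies outside the prime. Multiplying by it
  selects one piece, so the induction descends to a single fraction while the product u of all
  multipliers stays outside q.\<close>

lemma local_fraction: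
  assumes q: "primeideal q B" and b: "b \<in> carrier B"
  shows "\<exists>u\<in>carrier B - q. \<exists>a s. eta s \<notin> q \<and> u \<otimes> (eta s \<otimes> b) = u \<otimes> eta a"
proof -
  interpret q: primeideal q B by fact
  interpret S: mult_submonoid B "carrier B - q" by (rule q.mult_submonoid_compl)
  have compl: "e \<in> carrier B - q \<or> e' \<in> carrier B - q" if "compl_idem B e e'" for e e'
    using compl_idemD[OF that] S.S_one q.a_closed[of e e'] by auto
  have "b \<in> piecewise_fractions"
    using b by (simp add: carrier_eq_piecewise_fractions)
  then show ?thesis
  proof induction
    case (fraction a s)
    show ?case
    proof (cases "eta s \<in> q")
      case False
      have "eta s \<otimes> (eta s \<otimes> (eta a \<otimes> x s)) = (eta s \<otimes> eta s \<otimes> x s) \<otimes> eta a"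
        by (simp add: m_ac)
      then have "eta s \<otimes> (eta s \<otimes> (eta a \<otimes> x s)) = eta s \<otimes> eta a"
        by (simp only: x_inv)
      then show ?thesis
        using False by (intro bexI[of _ "eta s"] exI[of _ s] exI[of _ a]) auto
    \<comment> \<open>If the denominator lies in q, the fraction vanishes on the piece of
      \<open>1 - eta s x s\<close>, which lies outside q; it is locally zero and is presented as
      0/1.\<close>
    next
      case True
      then have "eta s \<otimes> x s \<in> q"
        using q.I_r_closed by simp
      then have u: "\<one> \<ominus> eta s \<otimes> x s \<in> carrier B - q"
        using compl[OF eta_x_compl[of s]] by simp
      have "(\<one> \<ominus> eta s \<otimes> x s) \<otimes> (eta 1 \<otimes> (eta a \<otimes> x s)) = eta a \<otimes> ((\<one> \<ominus> eta s \<otimes> x s) \<otimes> x s)"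
        using u by (simp add: m_ac)
      then have "(\<one> \<ominus> eta s \<otimes> x s) \<otimes> (eta 1 \<otimes> (eta a \<otimes> x s)) = (\<one> \<ominus> eta s \<otimes> x s) \<otimes> eta 0"
        using u unfolding compl_mult_x by simp
      moreover have "eta 1 \<notin> q"
        using S.S_one by simp
      ultimately show ?thesis
        using u by blast
    qed
  next
    case (glue e e' b c)
    note E = compl_idemD[OF glue(1)]
    \<comment> \<open>Once f makes v agree with its component d, a multiplier u for d becomes the
      multiplier \<open>f u\<close> for v, with the same a and s.\<close>
    have step: "\<exists>u\<in>carrier B - q. \<exists>a s. eta s \<notin> q \<and> u \<otimes> (eta s \<otimes> v) = u \<otimes> eta a"
      if f: "f \<in> carrier B - q" and d: "d \<in> carrier B" and v: "v \<in> carrier B" "f \<otimes> v = f \<otimes> d"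
        and ih: "\<exists>u\<in>carrier B - q. \<exists>a s. eta s \<notin> q \<and> u \<otimes> (eta s \<otimes> d) = u \<otimes> eta a" for f d v
    proof -
      from ih obtain u a s where u: "u \<in> carrier B - q" "eta s \<notin> q"
        "u \<otimes> (eta s \<otimes> d) = u \<otimes> eta a" by blast
      have "(f \<otimes> u) \<otimes> (eta s \<otimes> v) = u \<otimes> eta s \<otimes> (f \<otimes> v)"
        using f u v(1) by (simp add: m_ac)
      also have "\<dots> = f \<otimes> (u \<otimes> (eta s \<otimes> d))"
        unfolding v(2) using f u(1) d by (simp add: m_ac)
      also have "\<dots> = (f \<otimes> u) \<otimes> eta a"
        unfolding u(3) using f u(1) by (simp add: m_ac)
      finally show ?thesis
        using S.S_mult[OF f u(1)] u(2) by blast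
    qed
    have bc: "b \<in> carrier B" "c \<in> carrier B"
      using glue(2,3) piecewise_fractions_closed by auto
    have "e \<otimes> (e \<otimes> b \<oplus> e' \<otimes> c) = (e \<otimes> e) \<otimes> b \<oplus> (e \<otimes> e') \<otimes> c"
      "e' \<otimes> (e \<otimes> b \<oplus> e' \<otimes> c) = (e' \<otimes> e) \<otimes> b \<oplus> (e' \<otimes> e') \<otimes> c"
      using E(1,2) bc by (simp_all add: r_distr m_assoc)
    then have "e \<otimes> (e \<otimes> b \<oplus> e' \<otimes> c) = e \<otimes> b" "e' \<otimes> (e \<otimes> b \<oplus> e' \<otimes> c) = e' \<otimes> c"
      using E bc by simp_all
    moreover have "e \<otimes> b \<oplus> e' \<otimes> c \<in> carrier B"
      using E bc by simp
    ultimately show ?case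
      using step[of e b] step[of e' c] glue.IH bc compl[OF glue(1)] by blast
  qed
qed

end

section \<open>Residue fields\<close>

context pointwise_inverse_ring
begin

text \<open>This is the first isomorphism theorem for the induced map h from R_p to B_q. Its kernel
  is known because B_q is a field in which zero is detected by numerators, and it is surjective
  because elements of B are locally fractions from R.\<close>

lemma residue_induced_iso:
  assumes q: "primeideal q B"
  shows "residue_induced type_ring (eta -` q) B q eta
    \<in> ring_iso (residue_field type_ring (eta -` q)) (loc_at B q)"
proof -
  interpret q: primeideal q B by fact
  define p where "p = eta -` q"
  interpret T: cring "type_ring :: 'r ring" by (rule type_ring_cring)
  interpret e: ring_hom_ring type_ring B eta
    by (rule ring_hom_ringI2) (unfold_locales, rule eta_hom)
  have one_q: "\<one> \<notin> q"
    using q.I_notcarr q.one_imp_carrier by blast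
  have p_prime: "primeideal p type_ring"
  proof (rule primeidealI)
    show "ideal p type_ring"
      using e.ideal_vimage[OF q.is_ideal] by (simp add: p_def vimage_def)
    show "carrier type_ring \<noteq> p"
    proof
      assume "carrier type_ring = p"
      then have "1 \<in> p"
        by auto
      then show False
        using one_q by (simp add: p_def)
    qed
    show "a \<in> p \<or> b \<in> p" if "a \<otimes>\<^bsub>type_ring\<^esub> b \<in> p" for a b
      using that q.I_prime[of "eta a" "eta b"] by (simp add: p_def)
  qed (rule type_ring_cring)
  interpret p: primeideal p type_ring by (rule p_prime)
  define Sp where "Sp = carrier type_ring - p"
  define Sq where "Sq = carrier B - q"
  interpret P: mult_submonoid type_ring Sp
    unfolding Sp_def by (rule p.mult_submonoid_compl)
  interpret Q: mult_submonoid B Sq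
    unfolding Sq_def by (rule q.mult_submonoid_compl)
  have Sp_iff: "s \<in> Sp \<longleftrightarrow> eta s \<in> Sq" for s
    by (simp add: Sp_def Sq_def p_def)
  let ?Lp = "Localization type_ring Sp" and ?Lq = "Localization B Sq"
  define h where "h = loc_induced type_ring p B q eta"
  interpret Lp: cring ?Lp by (rule P.Localization_cring)
  interpret Lq: cring ?Lq by (rule Q.Localization_cring)
  have h_class: "h (loc_class type_ring Sp a s) = loc_class B Sq (eta a) (eta s)" if s: "s \<in> Sp" for a s
  proof -
    have "loc_class B Sq (eta b) (eta t) = loc_class B Sq (eta a) (eta s)"
      if m: "(b, t) \<in> loc_class type_ring Sp a s" for b t
    proof -
      have t: "t \<in> Sp" and eq: "loc_class type_ring Sp b t = loc_class type_ring Sp a s"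
        using P.loc_class_memD[OF m] by auto
      then obtain u where u: "u \<in> Sp" "u * (b * s) = u * (a * t)"
        using P.loc_class_eq_iff[of b a t s] s by auto
      have "eta u \<otimes> (eta b \<otimes> eta s) = eta u \<otimes> (eta a \<otimes> eta t)"
        using arg_cong[OF u(2), of eta] by simp
      then show ?thesis
        using u(1) t s by (subst Q.loc_class_eq_iff) (auto simp: Sp_iff)
    qed
    note wd = this
    have "(\<Union>x\<in>loc_class type_ring Sp a s. loc_class B Sq (eta (fst x)) (eta (snd x)))
        = loc_class B Sq (eta a) (eta s)"
    proof (rule SUP_eq_const)
      show "loc_class type_ring Sp a s \<noteq> {}"
        using P.loc_class_self[of a s] s by auto
    qed (rule wd, simp)
    then show ?thesis
      by (simp only: h_def loc_induced_def Sq_def)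
  qed
  have h_hom: "h \<in> ring_hom ?Lp ?Lq"
  proof (rule ring_hom_memI)
    show "h U \<in> carrier ?Lq" if "U \<in> carrier ?Lp" for U
      using that by (rule P.Localization_cases) (simp add: h_class Q.loc_class_closed Sp_iff)
    show "h \<one>\<^bsub>?Lp\<^esub> = \<one>\<^bsub>?Lq\<^esub>"
      using h_class[OF P.S_one] by (simp add: P.one_Localization Q.one_Localization)
    fix U V assume UV: "U \<in> carrier ?Lp" "V \<in> carrier ?Lp"
    obtain a s where U: "s \<in> Sp" "U = loc_class type_ring Sp a s"
      using UV(1) by (rule P.Localization_cases)
    obtain b t where V: "t \<in> Sp" "V = loc_class type_ring Sp b t"
      using UV(2) by (rule P.Localization_cases)
    have st: "s * t \<in> Sp"
      using P.S_mult[OF U(1) V(1)] by simp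
    show "h (U \<otimes>\<^bsub>?Lp\<^esub> V) = h U \<otimes>\<^bsub>?Lq\<^esub> h V"
      using U(1) V(1) st unfolding U(2) V(2)
      by (simp add: P.mult_loc_class h_class Q.mult_loc_class Sp_iff)
    show "h (U \<oplus>\<^bsub>?Lp\<^esub> V) = h U \<oplus>\<^bsub>?Lq\<^esub> h V"
      using U(1) V(1) st unfolding U(2) V(2)
      by (simp add: P.add_loc_class h_class Q.add_loc_class Sp_iff)
  qed
  interpret h: ring_hom_ring ?Lp ?Lq h
    by (rule ring_hom_ringI2) (unfold_locales, rule h_hom)
  have ker_iff: "h (loc_class type_ring Sp a s) = \<zero>\<^bsub>?Lq\<^esub> \<longleftrightarrow> a \<in> p" if "s \<in> Sp" for a s
    using vnr_loc_at_field(2)[OF regular q, of "eta a" "eta s"] that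
    by (simp add: h_class Sp_iff loc_at_def p_def flip: Sq_def)
  let ?G = "loc_map type_ring p ` p"
  have G: "loc_map type_ring p a = loc_class type_ring Sp a 1" for a
    by (simp add: loc_map_def Sp_def)
  have one_Sp: "1 \<in> Sp"
    using P.S_one by simp
  have G_closed: "?G \<subseteq> carrier ?Lp"
    using P.loc_class_closed one_Sp by (auto simp: G)
  \<comment> \<open>A class a/s goes to zero exactly when a is in p, and then a/s = (a/1)(1/s) lies
    in the ideal generated by the a/1 with a in p.\<close>
  have ker: "genideal ?Lp ?G = a_kernel ?Lp ?Lq h"
  proof
    show "genideal ?Lp ?G \<subseteq> a_kernel ?Lp ?Lq h"
    proof (intro Lp.genideal_minimal h.kernel_is_ideal subsetI)
      fix U assume "U \<in> ?G"
      then obtain a where "a \<in> p" "U = loc_class type_ring Sp a 1"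
        unfolding G by blast
      then show "U \<in> a_kernel ?Lp ?Lq h"
        unfolding a_kernel_def' using ker_iff[OF one_Sp, of a] P.loc_class_closed[OF _ one_Sp, of a] by simp
    qed
    show "a_kernel ?Lp ?Lq h \<subseteq> genideal ?Lp ?G"
    proof
      fix U assume "U \<in> a_kernel ?Lp ?Lq h"
      then have U: "U \<in> carrier ?Lp" "h U = \<zero>\<^bsub>?Lq\<^esub>"
        unfolding a_kernel_def' by blast+
      obtain a s where as: "s \<in> Sp" "U = loc_class type_ring Sp a s"
        using U(1) by (rule P.Localization_cases)
      then have "a \<in> p"
        using U(2) ker_iff by simp
      then have "loc_class type_ring Sp a 1 \<in> genideal ?Lp ?G"
        using Lp.genideal_self[OF G_closed] unfolding G by blast
      then have "loc_class type_ring Sp a 1 \<otimes>\<^bsub>?Lp\<^esub> loc_class type_ring Sp 1 s \<in> genideal ?Lp ?G"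
        using ideal.I_r_closed[OF Lp.genideal_ideal[OF G_closed]] P.loc_class_closed as(1) by simp
      then show "U \<in> genideal ?Lp ?G"
        using as one_Sp by (simp add: P.mult_loc_class)
    qed
  qed
  have surj: "h ` carrier ?Lp = carrier ?Lq"
  proof (intro equalityI subsetI)
    fix V assume "V \<in> carrier ?Lq"
    then obtain b t where bt: "b \<in> carrier B" "t \<in> Sq" "V = loc_class B Sq b t"
      by (rule Q.Localization_cases)
    \<comment> \<open>Numerator and denominator are treated alike: locally b is a/s and t is a'/s',
      so b/t comes from a s' over s a'.\<close>
    obtain u a s where u: "u \<in> Sq" "eta s \<notin> q" "u \<otimes> (eta s \<otimes> b) = u \<otimes> eta a"
      using local_fraction[OF q bt(1)] unfolding Sq_def by blast
    obtain u' a' s' where u': "u' \<in> Sq" "eta s' \<notin> q" "u' \<otimes> (eta s' \<otimes> t) = u' \<otimes> eta a'"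
      using local_fraction[OF q Q.S_carr[OF bt(2)]] unfolding Sq_def by blast
    have "eta s' \<in> Sq" "eta s \<in> Sq"
      using u(2) u'(2) by (simp_all add: Sq_def)
    \<comment> \<open>The new denominator must stay outside q: the left side of \<open>u'(3)\<close>
      is a product of elements outside the prime, hence so is the right side and its factor
      \<open>eta a'\<close>.\<close>
    then have "u' \<otimes> eta a' \<in> Sq"
      using Q.S_mult u'(1) bt(2) by (simp flip: u'(3))
    then have a': "eta a' \<in> Sq"
      using q.I_l_closed[of "eta a'" u'] Q.S_carr[OF u'(1)] by (auto simp: Sq_def)
    note carr = bt(1) Q.S_carr[OF bt(2)] Q.S_carr[OF u(1)] Q.S_carr[OF u'(1)]
    have "(u \<otimes> u') \<otimes> (b \<otimes> eta (s * a')) = (u \<otimes> (eta s \<otimes> b)) \<otimes> (u' \<otimes> eta a')"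
      using carr by (simp add: m_ac)
    also have "\<dots> = (u \<otimes> eta a) \<otimes> (u' \<otimes> (eta s' \<otimes> t))"
      unfolding u(3) u'(3) ..
    also have "\<dots> = (u \<otimes> u') \<otimes> (eta (a * s') \<otimes> t)"
      using carr by (simp add: m_ac)
    finally have "(u \<otimes> u') \<otimes> (b \<otimes> eta (s * a')) = (u \<otimes> u') \<otimes> (eta (a * s') \<otimes> t)" .
    moreover have sa: "s * a' \<in> Sp"
      using \<open>eta s \<in> Sq\<close> a' Q.S_mult by (simp add: Sp_iff)
    ultimately have "V = loc_class B Sq (eta (a * s')) (eta (s * a'))"
      using bt(1,2) Q.S_mult[OF u(1) u'(1)] unfolding bt(3)
      by (subst Q.loc_class_eq_iff) (auto simp only: Sp_iff eta_simps(1))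
    then have "V = h (loc_class type_ring Sp (a * s') (s * a'))"
      using h_class[OF sa] by simp
    then show "V \<in> h ` carrier ?Lp"
      using P.loc_class_closed sa by auto
  qed (use h.hom_closed in blast)
  let ?f = "\<lambda>V. the_elem (h ` V)"
  have iso: "?f \<in> ring_iso (?Lp Quot genideal ?Lp ?G) ?Lq"
    unfolding ker by (rule h.FactRing_iso_set[OF surj])
  \<comment> \<open>On a coset of its kernel h is constant, so the image of V is a singleton, and
    the union defining \<open>residue_induced\<close> returns its only member.\<close>
  have eq: "residue_induced type_ring p B q eta V = ?f V" if V: "V \<in> carrier (?Lp Quot genideal ?Lp ?G)" for V
  proof -
    obtain W where "h ` V = {W}"
      using h.the_elem_wf[of V] V unfolding ker by blast
    moreover have "residue_induced type_ring p B q eta V = \<Union> (h ` V)"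
      by (simp only: residue_induced_def h_def)
    ultimately show ?thesis
      by (simp only: the_elem_eq cSup_singleton)
  qed
  interpret FR: ring "?Lp Quot genideal ?Lp ?G"
    using ideal.quotient_is_ring Lp.genideal_ideal[OF G_closed] by blast
  have "residue_induced type_ring p B q eta \<in> ring_iso (?Lp Quot genideal ?Lp ?G) ?Lq"
    using FR.ring_iso_restrict[OF iso] eq by blast
  then show ?thesis
    by (simp only: p_def residue_field_def loc_at_def Sp_def Sq_def)
qed

end

section \<open>The ring of pointwise inverses\<close>

text \<open>Serves at two levels: for a polynomial as a sum of terms and for a monomial as a sum of
  exponent entries.\<close>

lemma poly_mapping_single_add_induct [case_names zero add]:
  assumes "P 0" and "\<And>k v f. P f \<Longrightarrow> P (f + Poly_Mapping.single k v)"
  shows "P f"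
proof (induction f rule: update_induct)
  case const
  show ?case by (rule assms(1))
next
  case (update f a b)
  have "Poly_Mapping.update a b f = f + Poly_Mapping.single a b"
    using update.hyps(1)
    by (intro poly_mapping_eqI) (auto simp: Poly_Mapping.lookup_update lookup_add lookup_single in_keys_iff when_def)
  then show ?case
    using assms(2) update.IH by simp
qed

lemma single_single_power: "Poly_Mapping.single (Poly_Mapping.single s n) 1 = mp_var s ^ n"
proof (induction n)
  case (Suc n)
  have "Poly_Mapping.single s (Suc n) = Poly_Mapping.single s 1 + Poly_Mapping.single s n"
    by (simp flip: single_add)
  then show ?case
    by (simp only: power_Suc Suc.IH[symmetric]) (simp add: mp_var_def mult_single)
qed simp

lemma mpoly_induct [case_names const var add mult]:
  fixes f :: "'a::comm_ring_1 mpoly"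
  assumes const: "\<And>c. P (mp_const c)" and var: "\<And>s. P (mp_var s)"
    and add: "\<And>f g. P f \<Longrightarrow> P g \<Longrightarrow> P (f + g)" and mult: "\<And>f g. P f \<Longrightarrow> P g \<Longrightarrow> P (f * g)"
  shows "P f"
proof (induction f rule: poly_mapping_single_add_induct)
  case zero
  show ?case
    using const[of 0] by (simp add: mp_const_def)
next
  case (add m c f)
  have pow: "P (mp_var s ^ n)" for s n
  proof (induction n)
    case 0
    show ?case
      using const[of 1] by (simp add: mp_const_def)
  qed (simp add: var mult)
  have "P (Poly_Mapping.single m c)"
  proof (induction m rule: poly_mapping_single_add_induct)
    case zero
    show ?case
      using const[of c] by (simp add: mp_const_def)
  next
    case (add s n m)
    have "Poly_Mapping.single (m + Poly_Mapping.single s n) c = Poly_Mapping.single m c * mp_var s ^ n"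
      by (simp add: mult_single flip: single_single_power)
    then show ?case
      using mult add pow by simp
  qed
  then show ?case
    by (rule assms(3)[OF add])
qed

lemma pinv_ideal_ideal: "ideal pinv_ideal (type_ring :: 'a::comm_ring_1 mpoly ring)"
  unfolding pinv_ideal_def by (intro ring.genideal_ideal cring.axioms(1) type_ring_cring) auto

text \<open>The generators of the ideal become the two identities of a pointwise inverse in the
  quotient, and generation holds because every polynomial arises from constants and variables by
  sums and products.\<close>

lemma pointwise_inverse_ring_pinv_ring:
  "pointwise_inverse_ring (pinv_ring :: 'a::comm_ring_1 mpoly set ring) pinv_eta
    (\<lambda>s. pinv_ideal +>\<^bsub>type_ring\<^esub> mp_var s)"
proof -
  interpret T: cring "type_ring :: 'a mpoly ring" by (rule type_ring_cring)
  interpret I: ideal pinv_ideal "type_ring :: 'a mpoly ring" by (rule pinv_ideal_ideal)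
  interpret B: cring "pinv_ring :: 'a mpoly set ring"
    unfolding pinv_ring_def by (rule I.quotient_is_cring[OF type_ring_cring])
  define cos where "cos f = pinv_ideal +>\<^bsub>type_ring\<^esub> f" for f :: "'a mpoly"
  have "cos \<in> ring_hom type_ring pinv_ring"
    using I.rcos_ring_hom unfolding pinv_ring_def cos_def .
  note h = ring_hom_memE[OF this, simplified]
  have carr: "carrier pinv_ring = range cos"
    by (auto simp: pinv_ring_def FactRing_def A_RCOSETS_def' cos_def)
  have eq: "cos f = cos g" if "f - g \<in> pinv_ideal" for f g
    using T.quotient_eq_iff_same_a_r_cos[OF pinv_ideal_ideal, of f g] that by (simp add: cos_def)
  have gens: "mp_const s * mp_var s ^ 2 - mp_var s \<in> pinv_ideal"
    "mp_const (s ^ 2) * mp_var s - mp_const s \<in> pinv_ideal" for s :: 'a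
    using T.genideal_self[of "(\<lambda>s. mp_const s * mp_var s ^ 2 - mp_var s) ` UNIV \<union>
      (\<lambda>s. mp_const (s ^ 2) * mp_var s - mp_const s) ` UNIV"]
    unfolding pinv_ideal_def by auto
  have const_mult: "mp_const (a * b) = mp_const a * mp_const b" for a b :: 'a
    by (simp add: mp_const_def mult_single)
  have eta: "pinv_eta = (\<lambda>a. cos (mp_const a))"
    by (simp add: fun_eq_iff pinv_eta_def cos_def)
  have "pointwise_inverse_ring pinv_ring pinv_eta (\<lambda>s. cos (mp_var s))"
    unfolding eta
  proof
    show "(\<lambda>a. cos (mp_const a)) \<in> ring_hom type_ring pinv_ring"
    proof (rule ring_hom_memI)
      show "cos (mp_const \<one>\<^bsub>type_ring\<^esub>) = \<one>\<^bsub>pinv_ring\<^esub>"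
        using h(4) by (simp add: mp_const_def)
      fix a b :: 'a
      show "cos (mp_const (a \<oplus>\<^bsub>type_ring\<^esub> b)) = cos (mp_const a) \<oplus>\<^bsub>pinv_ring\<^esub> cos (mp_const b)"
        by (simp add: mp_const_def single_add flip: h(3))
    qed (simp_all add: h const_mult)
    fix s :: 'a
    show "cos (mp_var s) \<in> carrier pinv_ring"
      by (simp add: carr)
    show "cos (mp_const s) \<otimes>\<^bsub>pinv_ring\<^esub> (cos (mp_var s) \<otimes>\<^bsub>pinv_ring\<^esub> cos (mp_var s)) = cos (mp_var s)"
      using eq[OF gens(1)[of s]] by (simp add: power2_eq_square h)
    show "cos (mp_const s) \<otimes>\<^bsub>pinv_ring\<^esub> cos (mp_const s) \<otimes>\<^bsub>pinv_ring\<^esub> cos (mp_var s) = cos (mp_const s)"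
      using eq[OF gens(2)[of s]] by (simp add: power2_eq_square h const_mult)
  next
    fix T
    assume "range (\<lambda>a. cos (mp_const a)) \<subseteq> T" "range (\<lambda>s. cos (mp_var s)) \<subseteq> T"
      "\<And>a b. a \<in> T \<Longrightarrow> b \<in> T \<Longrightarrow> a \<oplus>\<^bsub>pinv_ring\<^esub> b \<in> T"
      "\<And>a b. a \<in> T \<Longrightarrow> b \<in> T \<Longrightarrow> a \<otimes>\<^bsub>pinv_ring\<^esub> b \<in> T"
    then have "cos f \<in> T" for f
      by (induction f rule: mpoly_induct) (auto simp: h)
    then show "carrier pinv_ring \<subseteq> T"
      by (auto simp: carr)
  qed
  then show ?thesis
    by (simp add: cos_def)
qed

section \<open>Flatness over von Neumann regular rings\<close>

text \<open>The evaluation map from the free module on the elements of M to M. Row sums and column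
  sums of a matrix are its values.\<close>

definition lincomb :: "('a, 'r) ring_scheme \<Rightarrow> ('a, 'm, 's) module_scheme \<Rightarrow> ('m \<Rightarrow> 'a) \<Rightarrow> 'm" where
  "lincomb A M c = finsum M (\<lambda>m. c m \<odot>\<^bsub>M\<^esub> m) {m. c m \<noteq> \<zero>\<^bsub>A\<^esub>}"

lemma free_linD:
  assumes "z \<in> free_lin A U"
  shows "z x \<in> carrier A" "x \<notin> U \<Longrightarrow> z x = \<zero>\<^bsub>A\<^esub>" "finite {x. z x \<noteq> \<zero>\<^bsub>A\<^esub>}" "{x. z x \<noteq> \<zero>\<^bsub>A\<^esub>} \<subseteq> U"
  using assms by (auto simp: free_lin_def)

lemma free_lin_zero: "ring A \<Longrightarrow> (\<lambda>_. \<zero>\<^bsub>A\<^esub>) \<in> free_lin A U"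
  using ring.ring_simprules by (auto simp: free_lin_def)

lemma free_lin_col: "a \<in> free_lin A (U \<times> V) \<Longrightarrow> (\<lambda>n. a (n, m)) \<in> free_lin A U"
  and free_lin_row: "a \<in> free_lin A (U \<times> V) \<Longrightarrow> (\<lambda>m. a (n, m)) \<in> free_lin A V"
proof -
  assume a: "a \<in> free_lin A (U \<times> V)"
  have "{n. a (n, m) \<noteq> \<zero>\<^bsub>A\<^esub>} \<subseteq> fst ` {x. a x \<noteq> \<zero>\<^bsub>A\<^esub>}" "{m. a (n, m) \<noteq> \<zero>\<^bsub>A\<^esub>} \<subseteq> snd ` {x. a x \<noteq> \<zero>\<^bsub>A\<^esub>}"
    by force+
  then show "(\<lambda>n. a (n, m)) \<in> free_lin A U" "(\<lambda>m. a (n, m)) \<in> free_lin A V"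
    using a finite_subset[OF _ finite_imageI] unfolding free_lin_def by blast+
qed

section \<open>Finitely supported functions and the generalized inverse of a row\<close>

context cring
begin

lemma free_lin_add: "z \<in> free_lin R U \<Longrightarrow> w \<in> free_lin R U \<Longrightarrow> fl_add R z w \<in> free_lin R U"
  unfolding free_lin_def fl_add_def
  by (auto intro: finite_subset[of _ "{x. z x \<noteq> \<zero>} \<union> {x. w x \<noteq> \<zero>}"])

lemma free_lin_minus: "z \<in> free_lin R U \<Longrightarrow> w \<in> free_lin R U \<Longrightarrow> fl_minus R z w \<in> free_lin R U"
  unfolding free_lin_def fl_minus_def
  by (auto simp: a_minus_def intro: finite_subset[of _ "{x. z x \<noteq> \<zero>} \<union> {x. w x \<noteq> \<zero>}"])

lemma free_lin_smult: "c \<in> carrier R \<Longrightarrow> z \<in> free_lin R U \<Longrightarrow> fl_smult R c z \<in> free_lin R U"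
  unfolding free_lin_def fl_smult_def by (auto intro: finite_subset[of _ "{x. z x \<noteq> \<zero>}"])

lemma free_lin_delta: "x \<in> U \<Longrightarrow> fl_delta R x \<in> free_lin R U"
  unfolding free_lin_def fl_delta_def by (auto intro: finite_subset[of _ "{x}"])

lemma fl_minus_conv: "z \<in> free_lin R U \<Longrightarrow> w \<in> free_lin R U \<Longrightarrow>
    fl_minus R z w = fl_add R z (fl_smult R (\<ominus> \<one>) w)"
  using free_linD(1)[of z R U] free_linD(1)[of w R U]
  by (auto simp: fl_minus_def fl_add_def fl_smult_def a_minus_def l_minus)

lemma free_lin_induct [consumes 1, case_names zero add]:
  assumes z: "z \<in> free_lin R U" and zero: "P (\<lambda>_. \<zero>)"
    and add: "\<And>z c x. z \<in> free_lin R U \<Longrightarrow> c \<in> carrier R \<Longrightarrow> x \<in> U \<Longrightarrow> P z \<Longrightarrow>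
      P (fl_add R z (fl_smult R c (fl_delta R x)))"
  shows "P z"
proof -
  have "\<forall>z\<in>free_lin R U. {x. z x \<noteq> \<zero>} \<subseteq> F \<longrightarrow> P z" if "finite F" for F
    using that
  proof (induction F rule: finite_induct)
    case empty
    have "P z" if "{x. z x \<noteq> \<zero>} \<subseteq> {}" for z
    proof -
      have "z = (\<lambda>_. \<zero>)"
        using that by auto
      then show ?thesis
        using zero by simp
    qed
    then show ?case by blast
  next
    case (insert y F)
    show ?case
    proof (intro ballI impI)
      fix z assume z: "z \<in> free_lin R U" "{x. z x \<noteq> \<zero>} \<subseteq> insert y F"
      show "P z"
      proof (cases "y \<in> U")
        case False
        then have "{x. z x \<noteq> \<zero>} \<subseteq> F"
          using free_linD(2)[OF z(1)] z(2) by auto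
        then show ?thesis
          using insert.IH z(1) by blast
      next
        case True
        define w where "w = z(y := \<zero>)"
        have "w \<in> free_lin R U"
          using z(1) unfolding w_def free_lin_def
          by (auto intro: finite_subset[of _ "{x. z x \<noteq> \<zero>}"])
        moreover have "{x. w x \<noteq> \<zero>} \<subseteq> F"
          using z(2) by (auto simp: w_def)
        ultimately have "P (fl_add R w (fl_smult R (z y) (fl_delta R y)))"
          using insert.IH add free_linD(1)[OF z(1)] True by blast
        moreover have "fl_add R w (fl_smult R (z y) (fl_delta R y)) = z"
          using free_linD(1)[OF z(1)] by (auto simp: fl_add_def fl_smult_def fl_delta_def w_def)
        ultimately show ?thesis by simp
      qed
    qed
  qed
  then show ?thesis
    using z free_linD(3)[OF z] by blast
qed

text \<open>A finitely generated ideal of a von Neumann regular ring is generated by an idempotent;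
  \<open>G\<close> expresses such an element through the generators. To adjoin \<open>c j\<close>,
  only its part \<open>g\<close> outside the ideal generated so far has to be covered, and
  \<open>g h\<close> with \<open>g^2 h = g\<close> does this.\<close>

lemma vnr_row_inverse:
  assumes vnr: "von_neumann_regular R" and Q: "finite Q" and c: "\<And>k. c k \<in> carrier R"
  shows "\<exists>G. (\<forall>k. G k \<in> carrier R) \<and> (\<forall>m\<in>Q. (\<Oplus>k\<in>Q. c k \<otimes> G k) \<otimes> c m = c m)"
  using Q
proof (induction Q rule: finite_induct)
  case empty
  then show ?case by (auto intro: exI[of _ "\<lambda>_. \<zero>"])
next
  case (insert j Q)
  then obtain G where G: "\<And>k. G k \<in> carrier R" "\<And>m. m \<in> Q \<Longrightarrow> (\<Oplus>k\<in>Q. c k \<otimes> G k) \<otimes> c m = c m"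
    by blast
  define e where "e = (\<Oplus>k\<in>Q. c k \<otimes> G k)"
  have e: "e \<in> carrier R" "\<And>m. m \<in> Q \<Longrightarrow> e \<otimes> c m = c m"
    using G c by (auto simp: e_def)
  have cj: "c j \<in> carrier R" by (rule c)
  have ee: "e \<otimes> e = e"
  proof -
    have "e \<otimes> (\<Oplus>k\<in>Q. c k \<otimes> G k) = (\<Oplus>k\<in>Q. e \<otimes> (c k \<otimes> G k))"
      using insert.hyps e c G by (intro finsum_rdistr) auto
    also have "\<dots> = (\<Oplus>k\<in>Q. c k \<otimes> G k)"
      using e c G by (intro finsum_cong') (auto simp flip: m_assoc)
    finally show ?thesis
      by (simp add: e_def)
  qed
  define g where "g = (\<one> \<ominus> e) \<otimes> c j"
  have g: "g \<in> carrier R"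
    using e cj by (simp add: g_def)
  obtain h where h: "h \<in> carrier R" "g \<otimes> g \<otimes> h = g"
    using vnr g by (auto simp: von_neumann_regular_def)
  \<comment> \<open>The coefficient h of \<open>c j\<close> contributes \<open>c j h\<close> instead
    of \<open>g h\<close>; the excess \<open>e c j h\<close> is removed by scaling the old
    coefficients by \<open>1 - h c j\<close>.\<close>
  define G' where "G' = (\<lambda>k. if k = j then h else (\<one> \<ominus> h \<otimes> c j) \<otimes> G k)"
  have "(\<Oplus>k\<in>Q. c k \<otimes> G' k) = (\<Oplus>k\<in>Q. (\<one> \<ominus> h \<otimes> c j) \<otimes> (c k \<otimes> G k))"
    using insert.hyps c G h by (intro finsum_cong') (auto simp: G'_def m_ac)
  also have "\<dots> = (\<one> \<ominus> h \<otimes> c j) \<otimes> e"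
    unfolding e_def using insert.hyps c G h by (intro finsum_rdistr[symmetric]) auto
  finally have sum: "(\<Oplus>k\<in>insert j Q. c k \<otimes> G' k) = c j \<otimes> h \<oplus> (\<one> \<ominus> h \<otimes> c j) \<otimes> e"
    using insert.hyps c G h by (subst finsum_insert) (auto simp: G'_def)
  also have "\<dots> = e \<oplus> g \<otimes> h"
    unfolding g_def using e(1) cj h(1) by algebra
  finally have sum: "(\<Oplus>k\<in>insert j Q. c k \<otimes> G' k) = e \<oplus> g \<otimes> h" .
  have "(e \<oplus> g \<otimes> h) \<otimes> c m = c m" if m: "m \<in> insert j Q" for m
  proof (cases "m = j")
    case True
    have "g \<otimes> (\<one> \<ominus> e) = (\<one> \<ominus> e \<ominus> e \<oplus> e \<otimes> e) \<otimes> c j"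
      unfolding g_def using e(1) cj by algebra
    also have "\<dots> = g"
      unfolding ee g_def using e(1) cj by algebra
    \<comment> \<open>As \<open>e\<close> is idempotent, \<open>g\<close> absorbs
      \<open>1 - e\<close>; hence \<open>g h\<close> sends \<open>c j\<close> to
      \<open>g^2 h = g\<close>, the part that \<open>e\<close> misses.\<close>
    finally have "g \<otimes> h \<otimes> c j = (g \<otimes> (\<one> \<ominus> e)) \<otimes> h \<otimes> c j"
      by simp
    also have "\<dots> = g \<otimes> g \<otimes> h"
      unfolding g_def using e(1) cj h(1) by algebra
    finally have "g \<otimes> h \<otimes> c j = g"
      using h by simp
    moreover have "e \<otimes> c j \<oplus> g = c j"
      unfolding g_def using e(1) cj by algebra
    ultimately show ?thesis
      using True e(1) cj g h(1) by (simp add: l_distr)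
  next
    case False
    then have em: "e \<otimes> c m = c m"
      using m e by auto
    have cm: "c m \<in> carrier R" by (rule c)
    \<comment> \<open>The correction \<open>g h\<close> has the factor \<open>1 - e\<close>, which
      annihilates the old entries.\<close>
    have "(e \<oplus> g \<otimes> h) \<otimes> c m = e \<otimes> c m \<oplus> h \<otimes> c j \<otimes> (c m \<ominus> e \<otimes> c m)"
      unfolding g_def using e(1) cj h(1) cm by algebra
    then show ?thesis
      unfolding em using cm cj h(1) by (simp add: a_minus_def r_neg)
  qed
  moreover have "\<forall>k. G' k \<in> carrier R"
    using G h cj by (auto simp: G'_def)
  ultimately show ?case
    unfolding sum[symmetric] by blast
qed

end

section \<open>Evaluation of formal combinations in a module\<close>

context module
begin

lemma lincomb_superset:
  assumes c: "c \<in> free_lin R (carrier M)" and F: "finite F" "F \<subseteq> carrier M" "{m. c m \<noteq> \<zero>} \<subseteq> F"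
  shows "lincomb R M c = (\<Oplus>\<^bsub>M\<^esub>m\<in>F. c m \<odot>\<^bsub>M\<^esub> m)"
  unfolding lincomb_def
proof (rule M.add.finprod_mono_neutral_cong_left)
  show "c m \<odot>\<^bsub>M\<^esub> m = \<zero>\<^bsub>M\<^esub>" if "m \<in> F - {m. c m \<noteq> \<zero>}" for m
    using that F by auto
  show "(\<lambda>m. c m \<odot>\<^bsub>M\<^esub> m) \<in> F \<rightarrow> carrier M"
    using F(2) free_linD(1)[OF c] by auto
qed (use F in auto)

lemma lincomb_closed: "c \<in> free_lin R (carrier M) \<Longrightarrow> lincomb R M c \<in> carrier M"
  unfolding lincomb_def by (rule M.finsum_closed) (use free_linD[of c R "carrier M"] in auto)

lemma lincomb_zero [simp]: "lincomb R M (\<lambda>_. \<zero>) = \<zero>\<^bsub>M\<^esub>"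
  by (simp add: lincomb_def)

lemma lincomb_add:
  assumes c: "c \<in> free_lin R (carrier M)" and d: "d \<in> free_lin R (carrier M)"
  shows "lincomb R M (fl_add R c d) = lincomb R M c \<oplus>\<^bsub>M\<^esub> lincomb R M d"
proof -
  let ?F = "{m. c m \<noteq> \<zero>} \<union> {m. d m \<noteq> \<zero>}"
  have F: "finite ?F" "?F \<subseteq> carrier M"
    using free_linD[OF c] free_linD[OF d] by auto
  have "lincomb R M (fl_add R c d) = (\<Oplus>\<^bsub>M\<^esub>m\<in>?F. fl_add R c d m \<odot>\<^bsub>M\<^esub> m)"
    using F R.free_lin_add[OF c d] by (intro lincomb_superset) (auto simp: fl_add_def)
  also have "\<dots> = (\<Oplus>\<^bsub>M\<^esub>m\<in>?F. c m \<odot>\<^bsub>M\<^esub> m \<oplus>\<^bsub>M\<^esub> d m \<odot>\<^bsub>M\<^esub> m)"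
    using F free_linD(1)[OF c] free_linD(1)[OF d]
    by (intro M.finsum_cong') (auto simp: fl_add_def smult_l_distr)
  also have "\<dots> = (\<Oplus>\<^bsub>M\<^esub>m\<in>?F. c m \<odot>\<^bsub>M\<^esub> m) \<oplus>\<^bsub>M\<^esub> (\<Oplus>\<^bsub>M\<^esub>m\<in>?F. d m \<odot>\<^bsub>M\<^esub> m)"
    using F free_linD(1)[OF c] free_linD(1)[OF d] by (intro M.finsum_addf) auto
  also have "\<dots> = lincomb R M c \<oplus>\<^bsub>M\<^esub> lincomb R M d"
    using lincomb_superset[OF c F] lincomb_superset[OF d F] by simp
  finally show ?thesis .
qed

lemma lincomb_smult:
  assumes k: "k \<in> carrier R" and c: "c \<in> free_lin R (carrier M)"
  shows "lincomb R M (fl_smult R k c) = k \<odot>\<^bsub>M\<^esub> lincomb R M c"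
proof -
  let ?F = "{m. c m \<noteq> \<zero>}"
  have F: "finite ?F" "?F \<subseteq> carrier M"
    using free_linD[OF c] by auto
  have "lincomb R M (fl_smult R k c) = (\<Oplus>\<^bsub>M\<^esub>m\<in>?F. fl_smult R k c m \<odot>\<^bsub>M\<^esub> m)"
    using F R.free_lin_smult[OF k c] k by (intro lincomb_superset) (auto simp: fl_smult_def)
  also have "\<dots> = (\<Oplus>\<^bsub>M\<^esub>m\<in>?F. k \<odot>\<^bsub>M\<^esub> (c m \<odot>\<^bsub>M\<^esub> m))"
    using F k free_linD(1)[OF c]
    by (intro M.finsum_cong') (auto simp: fl_smult_def smult_assoc1)
  also have "\<dots> = k \<odot>\<^bsub>M\<^esub> (\<Oplus>\<^bsub>M\<^esub>m\<in>?F. c m \<odot>\<^bsub>M\<^esub> m)"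
    using F k free_linD(1)[OF c] by (intro finsum_smult_ldistr[symmetric]) auto
  finally show ?thesis
    by (simp add: lincomb_def)
qed

lemma lincomb_minus:
  assumes c: "c \<in> free_lin R (carrier M)" and d: "d \<in> free_lin R (carrier M)"
  shows "lincomb R M (fl_minus R c d) = lincomb R M c \<ominus>\<^bsub>M\<^esub> lincomb R M d"
  using assms lincomb_closed
  by (simp add: R.fl_minus_conv lincomb_add R.free_lin_smult lincomb_smult smult_l_minus a_minus_def)

lemma lincomb_delta:
  assumes "m \<in> carrier M"
  shows "lincomb R M (fl_delta R m) = m"
proof -
  have "lincomb R M (fl_delta R m) = (\<Oplus>\<^bsub>M\<^esub>k\<in>{m}. fl_delta R m k \<odot>\<^bsub>M\<^esub> k)"
    using assms R.free_lin_delta by (intro lincomb_superset) (auto simp: fl_delta_def)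
  then show ?thesis
    using assms by (simp add: fl_delta_def)
qed

end

text \<open>With K the kernel of the evaluation from the free module A^(N) to N, this is K (x) A^(M)
  inside the free module on N x M. \<open>zero_rows\<close> is the corresponding submodule for the
  kernel of the evaluation to M.\<close>

definition zero_cols :: "('a, 'r) ring_scheme \<Rightarrow> ('a, 'n) module \<Rightarrow> ('a, 'm) module \<Rightarrow> ('n \<times> 'm \<Rightarrow> 'a) set" where
  "zero_cols A N M = {a \<in> free_lin A (carrier N \<times> carrier M).
     \<forall>m. lincomb A N (\<lambda>n. a (n, m)) = \<zero>\<^bsub>N\<^esub>}"

definition zero_rows :: "('a, 'r) ring_scheme \<Rightarrow> ('a, 'n) module \<Rightarrow> ('a, 'm) module \<Rightarrow> ('n \<times> 'm \<Rightarrow> 'a) set" where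
  "zero_rows A N M = {a \<in> free_lin A (carrier N \<times> carrier M).
     \<forall>n. lincomb A M (\<lambda>m. a (n, m)) = \<zero>\<^bsub>M\<^esub>}"

lemma fl_component:
  "(\<lambda>m. fl_add A a b (n, m)) = fl_add A (\<lambda>m. a (n, m)) (\<lambda>m. b (n, m))"
  "(\<lambda>n. fl_add A a b (n, m)) = fl_add A (\<lambda>n. a (n, m)) (\<lambda>n. b (n, m))"
  "(\<lambda>m. fl_minus A a b (n, m)) = fl_minus A (\<lambda>m. a (n, m)) (\<lambda>m. b (n, m))"
  "(\<lambda>n. fl_minus A a b (n, m)) = fl_minus A (\<lambda>n. a (n, m)) (\<lambda>n. b (n, m))"
  "(\<lambda>m. fl_smult A c a (n, m)) = fl_smult A c (\<lambda>m. a (n, m))"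
  "(\<lambda>n. fl_smult A c a (n, m)) = fl_smult A c (\<lambda>n. a (n, m))"
  "(\<lambda>m. fl_delta A (n', m') (n, m)) = (if n = n' then fl_delta A m' else (\<lambda>_. \<zero>\<^bsub>A\<^esub>))"
  "(\<lambda>n. fl_delta A (n', m') (n, m)) = (if m = m' then fl_delta A n' else (\<lambda>_. \<zero>\<^bsub>A\<^esub>))"
  by (auto simp: fl_add_def fl_minus_def fl_smult_def fl_delta_def)

lemma swap_components:
  "(\<lambda>x. fl_add A a b (prod.swap x)) = fl_add A (\<lambda>x. a (prod.swap x)) (\<lambda>x. b (prod.swap x))"
  "(\<lambda>x. fl_minus A a b (prod.swap x)) = fl_minus A (\<lambda>x. a (prod.swap x)) (\<lambda>x. b (prod.swap x))"
  "(\<lambda>x. fl_smult A c a (prod.swap x)) = fl_smult A c (\<lambda>x. a (prod.swap x))"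
  "(\<lambda>x. fl_delta A (n, m) (prod.swap x)) = fl_delta A (m, n)"
  by (auto simp: fl_add_def fl_minus_def fl_smult_def fl_delta_def fun_eq_iff)

lemma free_lin_swap:
  assumes "a \<in> free_lin A (U \<times> V)"
  shows "(\<lambda>x. a (prod.swap x)) \<in> free_lin A (V \<times> U)"
proof -
  have "{x. a (prod.swap x) \<noteq> \<zero>\<^bsub>A\<^esub>} \<subseteq> prod.swap ` {x. a x \<noteq> \<zero>\<^bsub>A\<^esub>}"
    by force
  then show ?thesis
    using assms finite_subset[OF _ finite_imageI] unfolding free_lin_def by fastforce
qed

text \<open>Exchanging the two factors permutes the four families of relations, so facts about zero
  columns transfer to zero rows.\<close>

lemma tensor_rels_swap: "z \<in> tensor_rels A N M \<Longrightarrow> (\<lambda>x. z (prod.swap x)) \<in> tensor_rels A M N"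
  unfolding tensor_rels_def by (elim UnE CollectE exE conjE) (simp_all add: swap_components, blast+)

lemma tensor_span_swap: "z \<in> tensor_span A N M \<Longrightarrow> (\<lambda>x. z (prod.swap x)) \<in> tensor_span A M N"
  by (induction rule: tensor_span.induct)
    (auto simp: swap_components intro: tensor_span.intros tensor_rels_swap)

locale tensor_modules = cring A for A :: "('a, 'r) ring_scheme" (structure) +
  fixes N :: "('a, 'n) module" and M :: "('a, 'm) module"
  assumes N_module: "module A N" and M_module: "module A M"

sublocale tensor_modules \<subseteq> N: module A N
  by (rule N_module)

sublocale tensor_modules \<subseteq> M: module A M
  by (rule M_module)

section \<open>Tensor relations as matrices with zero column or row sums\<close>

context tensor_modules
begin

abbreviation FL where "FL \<equiv> free_lin A (carrier N \<times> carrier M)"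

abbreviation delta where "delta \<equiv> fl_delta A"

lemma tensor_rels_cases:
  assumes "z \<in> tensor_rels A N M"
  obtains (add_left) n1 n2 m where "n1 \<in> carrier N" "n2 \<in> carrier N" "m \<in> carrier M"
      "z = fl_minus A (delta (n1 \<oplus>\<^bsub>N\<^esub> n2, m)) (fl_add A (delta (n1, m)) (delta (n2, m)))"
  | (add_right) n m1 m2 where "n \<in> carrier N" "m1 \<in> carrier M" "m2 \<in> carrier M"
      "z = fl_minus A (delta (n, m1 \<oplus>\<^bsub>M\<^esub> m2)) (fl_add A (delta (n, m1)) (delta (n, m2)))"
  | (smult_left) c n m where "c \<in> carrier A" "n \<in> carrier N" "m \<in> carrier M"
      "z = fl_minus A (delta (c \<odot>\<^bsub>N\<^esub> n, m)) (fl_smult A c (delta (n, m)))"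
  | (smult_right) c n m where "c \<in> carrier A" "n \<in> carrier N" "m \<in> carrier M"
      "z = fl_minus A (delta (n, c \<odot>\<^bsub>M\<^esub> m)) (fl_smult A c (delta (n, m)))"
  using assms unfolding tensor_rels_def
  by (elim UnE CollectE exE conjE) (rule that; assumption)+

lemma zero_cols_closed:
  "(\<lambda>_. \<zero>) \<in> zero_cols A N M"
  "a \<in> zero_cols A N M \<Longrightarrow> b \<in> zero_cols A N M \<Longrightarrow> fl_add A a b \<in> zero_cols A N M"
  "c \<in> carrier A \<Longrightarrow> a \<in> zero_cols A N M \<Longrightarrow> fl_smult A c a \<in> zero_cols A N M"
  unfolding zero_cols_def
  by (auto simp: fl_component N.lincomb_add N.lincomb_smult free_lin_col free_lin_add
      free_lin_smult free_lin_zero[OF ring_axioms])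

lemma zero_rows_closed:
  "(\<lambda>_. \<zero>) \<in> zero_rows A N M"
  "a \<in> zero_rows A N M \<Longrightarrow> b \<in> zero_rows A N M \<Longrightarrow> fl_add A a b \<in> zero_rows A N M"
  "c \<in> carrier A \<Longrightarrow> a \<in> zero_rows A N M \<Longrightarrow> fl_smult A c a \<in> zero_rows A N M"
  unfolding zero_rows_def
  by (auto simp: fl_component M.lincomb_add M.lincomb_smult free_lin_row free_lin_add
      free_lin_smult free_lin_zero[OF ring_axioms])

lemma fl_add_zero_left: "a \<in> free_lin A U \<Longrightarrow> fl_add A (\<lambda>_. \<zero>) a = a"
  and fl_add_zero_right: "a \<in> free_lin A U \<Longrightarrow> fl_add A a (\<lambda>_. \<zero>) = a"
  using free_linD(1)[of a A U] by (auto simp: fl_add_def)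

lemma fl_add_add:
  assumes "a \<in> free_lin A U" "b \<in> free_lin A U" "c \<in> free_lin A U" "d \<in> free_lin A U"
  shows "fl_add A (fl_add A a b) (fl_add A c d) = fl_add A (fl_add A a c) (fl_add A b d)"
  using assms[THEN free_linD(1)] by (auto simp: fl_add_def a_ac)

lemma fl_smult_add:
  assumes "a \<in> free_lin A U" "b \<in> free_lin A U" "c \<in> carrier A"
  shows "fl_smult A c (fl_add A a b) = fl_add A (fl_smult A c a) (fl_smult A c b)"
  using assms(1,2)[THEN free_linD(1)] assms(3) by (auto simp: fl_add_def fl_smult_def r_distr)

text \<open>A relation in the left factor lives in one column and evaluates to zero in N; one in the
  right factor lives in one row and evaluates to zero in M.\<close>

lemma tensor_rels_subset:
  assumes "z \<in> tensor_rels A N M"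
  shows "z \<in> zero_cols A N M \<union> zero_rows A N M"
  using assms
proof (cases rule: tensor_rels_cases)
  case (add_left n1 n2 m)
  then show ?thesis
    unfolding zero_cols_def
    by (auto simp: fl_component N.lincomb_add N.lincomb_minus N.lincomb_delta free_lin_add
      free_lin_minus free_lin_delta a_minus_def N.M.r_neg N.lincomb_zero free_lin_zero[OF ring_axioms])
next
  case (add_right n m1 m2)
  then show ?thesis
    unfolding zero_rows_def
    by (auto simp: fl_component M.lincomb_add M.lincomb_minus M.lincomb_delta free_lin_add
      free_lin_minus free_lin_delta a_minus_def M.M.r_neg M.lincomb_zero free_lin_zero[OF ring_axioms])
next
  case (smult_left c n m)
  then show ?thesis
    unfolding zero_cols_def
    by (auto simp: fl_component N.lincomb_smult N.lincomb_minus N.lincomb_delta free_lin_smult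
      free_lin_minus free_lin_delta a_minus_def N.M.r_neg N.lincomb_zero free_lin_zero[OF ring_axioms])
next
  case (smult_right c n m)
  then show ?thesis
    unfolding zero_rows_def
    by (auto simp: fl_component M.lincomb_smult M.lincomb_minus M.lincomb_delta free_lin_smult
      free_lin_minus free_lin_delta a_minus_def M.M.r_neg M.lincomb_zero free_lin_zero[OF ring_axioms])
qed

text \<open>Both submodules are closed under the operations that build the span, so contributions of
  the two kinds can be collected separately. An inductively generated relation thus becomes a pair
  of matrices that can be edited.\<close>

lemma tensor_span_decompose:
  assumes "z \<in> tensor_span A N M"
  shows "\<exists>a\<in>zero_cols A N M. \<exists>r\<in>zero_rows A N M. z = fl_add A a r"
  using assms
proof induction
  case ts_zero
  have "(\<lambda>_. \<zero>) = fl_add A (\<lambda>_::'n \<times> 'm. \<zero>) (\<lambda>_. \<zero>)"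
    by (simp add: fl_add_def)
  then show ?case
    using zero_cols_closed(1) zero_rows_closed(1) by blast
next
  case (ts_rel z)
  have "z \<in> FL"
    using tensor_rels_subset[OF ts_rel] by (auto simp: zero_cols_def zero_rows_def)
  then show ?case
    using tensor_rels_subset[OF ts_rel] zero_cols_closed(1) zero_rows_closed(1)
      fl_add_zero_left[of z] fl_add_zero_right[of z] by (metis UnE)
next
  case (ts_add z w)
  then obtain a r b s where *: "a \<in> zero_cols A N M" "r \<in> zero_rows A N M" "z = fl_add A a r"
    "b \<in> zero_cols A N M" "s \<in> zero_rows A N M" "w = fl_add A b s" by blast
  then have "fl_add A z w = fl_add A (fl_add A a b) (fl_add A r s)"
    by (auto simp: zero_cols_def zero_rows_def intro: fl_add_add)
  then show ?case
    using * zero_cols_closed(2) zero_rows_closed(2) by blast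
next
  case (ts_smult c z)
  then obtain a r where *: "a \<in> zero_cols A N M" "r \<in> zero_rows A N M" "z = fl_add A a r" by blast
  then have "fl_smult A c z = fl_add A (fl_smult A c a) (fl_smult A c r)"
    using ts_smult.hyps by (auto simp: zero_cols_def zero_rows_def intro: fl_smult_add)
  then show ?case
    using * ts_smult.hyps zero_cols_closed(3) zero_rows_closed(3) by blast
qed

lemma tensor_span_FL: "z \<in> tensor_span A N M \<Longrightarrow> z \<in> FL"
  using tensor_span_decompose[of z] free_lin_add by (auto simp: zero_cols_def zero_rows_def)

text \<open>Equality in the tensor product, at the level of representatives.\<close>

definition tcong :: "('n \<times> 'm \<Rightarrow> 'a) \<Rightarrow> ('n \<times> 'm \<Rightarrow> 'a) \<Rightarrow> bool" where
  "tcong z w \<longleftrightarrow> z \<in> FL \<and> w \<in> FL \<and> fl_minus A z w \<in> tensor_span A N M"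

lemma tcong_refl: "z \<in> FL \<Longrightarrow> tcong z z"
  using tensor_span.ts_zero[of A N M] free_linD(1)[of z A]
  by (simp add: tcong_def fl_minus_def a_minus_def r_neg)

lemma tcong_sym:
  assumes "tcong z w"
  shows "tcong w z"
proof -
  have c: "z \<in> FL" "w \<in> FL" using assms by (auto simp: tcong_def)
  have "fl_minus A w z = fl_smult A (\<ominus> \<one>) (fl_minus A z w)"
    using c[THEN free_linD(1)]
    by (auto simp: fl_minus_def fl_smult_def a_minus_def l_minus minus_add a_comm)
  then show ?thesis
    using assms tensor_span.ts_smult[of "\<ominus> \<one>" A _ N M] by (simp add: tcong_def)
qed

lemma tcong_trans:
  assumes "tcong z w" "tcong w v"
  shows "tcong z v"
proof -
  have c: "z \<in> FL" "w \<in> FL" "v \<in> FL" using assms by (auto simp: tcong_def)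
  have "z x \<ominus> v x = (z x \<ominus> w x) \<oplus> (w x \<ominus> v x)" for x
    using c[THEN free_linD(1), of x] by algebra
  then have "fl_minus A z v = fl_add A (fl_minus A z w) (fl_minus A w v)"
    by (simp add: fl_minus_def fl_add_def)
  then show ?thesis
    using assms tensor_span.ts_add[of _ A N M] by (simp add: tcong_def)
qed

lemma tcong_add:
  assumes "tcong z w" "tcong z' w'"
  shows "tcong (fl_add A z z') (fl_add A w w')"
proof -
  have c: "z \<in> FL" "w \<in> FL" "z' \<in> FL" "w' \<in> FL" using assms by (auto simp: tcong_def)
  have "(z x \<oplus> z' x) \<ominus> (w x \<oplus> w' x) = (z x \<ominus> w x) \<oplus> (z' x \<ominus> w' x)" for x
    using c[THEN free_linD(1), of x] by algebra
  then have "fl_minus A (fl_add A z z') (fl_add A w w') = fl_add A (fl_minus A z w) (fl_minus A z' w')"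
    by (simp add: fl_minus_def fl_add_def)
  then show ?thesis
    using assms tensor_span.ts_add[of _ A N M] c by (simp add: tcong_def free_lin_add)
qed

lemma tcong_zero_iff: "tcong z (\<lambda>_. \<zero>) \<longleftrightarrow> z \<in> tensor_span A N M"
proof -
  have "fl_minus A z (\<lambda>_. \<zero>) = z" if "z \<in> FL"
    using free_linD(1)[OF that] by (auto simp: fl_minus_def a_minus_def)
  then show ?thesis
    using tensor_span_FL free_lin_zero[OF ring_axioms] by (auto simp: tcong_def)
qed

lemma tcong_delta_add:
  assumes "n1 \<in> carrier N" "n2 \<in> carrier N" "m \<in> carrier M"
  shows "tcong (fl_add A (delta (n1, m)) (delta (n2, m))) (delta (n1 \<oplus>\<^bsub>N\<^esub> n2, m))"
proof (rule tcong_sym)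
  have "fl_minus A (delta (n1 \<oplus>\<^bsub>N\<^esub> n2, m)) (fl_add A (delta (n1, m)) (delta (n2, m))) \<in> tensor_rels A N M"
    using assms unfolding tensor_rels_def by blast
  then show "tcong (delta (n1 \<oplus>\<^bsub>N\<^esub> n2, m)) (fl_add A (delta (n1, m)) (delta (n2, m)))"
    using assms by (auto simp: tcong_def free_lin_add free_lin_delta intro: tensor_span.ts_rel)
qed

lemma tcong_delta_smult:
  assumes "c \<in> carrier A" "n \<in> carrier N" "m \<in> carrier M"
  shows "tcong (fl_smult A c (delta (n, m))) (delta (c \<odot>\<^bsub>N\<^esub> n, m))"
proof (rule tcong_sym)
  have "fl_minus A (delta (c \<odot>\<^bsub>N\<^esub> n, m)) (fl_smult A c (delta (n, m))) \<in> tensor_rels A N M"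
    using assms unfolding tensor_rels_def by blast
  then show "tcong (delta (c \<odot>\<^bsub>N\<^esub> n, m)) (fl_smult A c (delta (n, m)))"
    using assms by (auto simp: tcong_def free_lin_smult free_lin_delta intro: tensor_span.ts_rel)
qed

lemma tcong_delta_zero:
  assumes "m \<in> carrier M"
  shows "tcong (\<lambda>_. \<zero>) (delta (\<zero>\<^bsub>N\<^esub>, m))"
proof -
  have "fl_smult A \<zero> (delta (\<zero>\<^bsub>N\<^esub>, m)) = (\<lambda>_. \<zero>)"
    by (auto simp: fl_smult_def fl_delta_def)
  then show ?thesis
    using tcong_delta_smult[of \<zero> "\<zero>\<^bsub>N\<^esub>" m] assms by simp
qed

definition column :: "'m \<Rightarrow> ('n \<Rightarrow> 'a) \<Rightarrow> 'n \<times> 'm \<Rightarrow> 'a" where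
  "column m c = (\<lambda>(n, m'). if m' = m then c n else \<zero>)"

text \<open>The left-hand relations alone collapse a sum of elements \<open>c n (n (x) m)\<close>
  with fixed m to a single elementary tensor, term by term.\<close>

lemma tcong_column:
  assumes "c \<in> free_lin A (carrier N)" and m: "m \<in> carrier M"
  shows "tcong (column m c) (delta (lincomb A N c, m))"
  using assms(1)
proof (induction rule: free_lin_induct)
  case zero
  have "column m (\<lambda>_. \<zero>) = (\<lambda>_. \<zero>)"
    by (auto simp: column_def)
  then show ?case
    using tcong_delta_zero[OF m] by simp
next
  case (add c k n)
  have "column m (fl_add A c (fl_smult A k (delta n))) = fl_add A (column m c) (fl_smult A k (delta (n, m)))"
    using add.hyps by (auto simp: column_def fl_add_def fl_smult_def fl_delta_def)
  moreover have "tcong (fl_add A (column m c) (fl_smult A k (delta (n, m))))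
      (fl_add A (delta (lincomb A N c, m)) (delta (k \<odot>\<^bsub>N\<^esub> n, m)))"
    using add m by (intro tcong_add tcong_delta_smult)
  moreover have "tcong (fl_add A (delta (lincomb A N c, m)) (delta (k \<odot>\<^bsub>N\<^esub> n, m)))
      (delta (lincomb A N c \<oplus>\<^bsub>N\<^esub> k \<odot>\<^bsub>N\<^esub> n, m))"
    using add m N.lincomb_closed by (intro tcong_delta_add) auto
  moreover have "lincomb A N (fl_add A c (fl_smult A k (delta n))) = lincomb A N c \<oplus>\<^bsub>N\<^esub> k \<odot>\<^bsub>N\<^esub> n"
    using add.hyps by (simp add: N.lincomb_add N.lincomb_smult N.lincomb_delta free_lin_smult free_lin_delta)
  ultimately show ?case
    using tcong_trans by simp
qed

text \<open>Columns are split off one at a time. A column with sum zero is congruent to the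
  elementary tensor of zero with m, which is congruent to zero.\<close>

lemma zero_cols_subset_span: "zero_cols A N M \<subseteq> tensor_span A N M"
proof -
  have "\<forall>a\<in>zero_cols A N M. {m. \<exists>n. a (n, m) \<noteq> \<zero>} \<subseteq> Q \<longrightarrow> a \<in> tensor_span A N M" if "finite Q" for Q
    using that
  proof (induction Q rule: finite_induct)
    case empty
    show ?case
    proof (intro ballI impI)
      fix a :: "'n \<times> 'm \<Rightarrow> 'a" assume "{m. \<exists>n. a (n, m) \<noteq> \<zero>} \<subseteq> {}"
      then have "a = (\<lambda>_. \<zero>)"
        by auto
      then show "a \<in> tensor_span A N M"
        using tensor_span.ts_zero by simp
    qed
  next
    case (insert m Q)
    show ?case
    proof (intro ballI impI)
      fix a assume a: "a \<in> zero_cols A N M" "{m. \<exists>n. a (n, m) \<noteq> \<zero>} \<subseteq> insert m Q"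
      have aFL: "a \<in> FL" using a(1) by (simp add: zero_cols_def)
      define b where "b = (\<lambda>(n, m'). if m' = m then \<zero> else a (n, m'))"
      have "{x. b x \<noteq> \<zero>} \<subseteq> {x. a x \<noteq> \<zero>}"
        by (auto simp: b_def split: if_splits)
      then have "b \<in> FL"
        using aFL finite_subset by (auto simp: free_lin_def b_def)
      moreover have "lincomb A N (\<lambda>n. b (n, m')) = \<zero>\<^bsub>N\<^esub>" for m'
        using a(1) by (cases "m' = m") (simp_all add: b_def zero_cols_def N.lincomb_zero)
      ultimately have "b \<in> zero_cols A N M"
        by (simp add: zero_cols_def)
      moreover have "{m. \<exists>n. b (n, m) \<noteq> \<zero>} \<subseteq> Q"
        using a(2) by (auto simp: b_def split: if_splits)
      ultimately have b: "b \<in> tensor_span A N M"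
        using insert.IH by blast
      have col: "column m (\<lambda>n. a (n, m)) \<in> tensor_span A N M"
      proof (cases "m \<in> carrier M")
        case True
        then have "tcong (column m (\<lambda>n. a (n, m))) (delta (\<zero>\<^bsub>N\<^esub>, m))"
          using tcong_column[OF free_lin_col[OF aFL] True] a(1) by (simp add: zero_cols_def)
        then show ?thesis
          using tcong_trans tcong_sym tcong_delta_zero[OF True] tcong_zero_iff by blast
      next
        case False
        then have "a (n, m) = \<zero>" for n
          using free_linD(2)[OF aFL] by auto
        then have "column m (\<lambda>n. a (n, m)) = (\<lambda>_. \<zero>)"
          by (auto simp: column_def)
        then show ?thesis
          using tensor_span.ts_zero by simp
      qed
      have "a = fl_add A b (column m (\<lambda>n. a (n, m)))"
        using free_linD(1)[OF aFL] by (auto simp: fl_add_def b_def column_def)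
      then show "a \<in> tensor_span A N M"
        using tensor_span.ts_add[OF b col] by simp
    qed
  qed
  moreover have "finite {m. \<exists>n. a (n, m) \<noteq> \<zero>}" if "a \<in> zero_cols A N M" for a
  proof -
    have "{m. \<exists>n. a (n, m) \<noteq> \<zero>} \<subseteq> snd ` {x. a x \<noteq> \<zero>}"
      by force
    then show ?thesis
      using that finite_subset[OF _ finite_imageI] by (auto simp: zero_cols_def free_lin_def)
  qed
  ultimately show ?thesis
    by blast
qed

end

lemma (in tensor_modules) zero_rows_subset_span: "zero_rows A N M \<subseteq> tensor_span A N M"
proof
  interpret sw: tensor_modules A M N
    by unfold_locales
  fix a assume a: "a \<in> zero_rows A N M"
  then have "(\<lambda>x. a (prod.swap x)) \<in> zero_cols A M N"
    by (auto simp: zero_rows_def zero_cols_def intro: free_lin_swap)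
  then have "(\<lambda>x. a (prod.swap x)) \<in> tensor_span A M N"
    using sw.zero_cols_subset_span by blast
  then show "a \<in> tensor_span A N M"
    using tensor_span_swap by fastforce
qed

section \<open>Clearing rows over a von Neumann regular ring\<close>

context tensor_modules
begin

text \<open>The kernel of the evaluation is a submodule, hence contains every combination of the
  columns. Finite support is carried through the induction because additivity of
  \<open>lincomb\<close> depends on it.\<close>

lemma lincomb_finsum_cols:
  assumes a: "a \<in> zero_cols A N M" and Q: "finite Q" and G: "\<And>k. G k \<in> carrier A"
  shows "(\<lambda>n. \<Oplus>k\<in>Q. a (n, k) \<otimes> G k) \<in> free_lin A (carrier N) \<and>
    lincomb A N (\<lambda>n. \<Oplus>k\<in>Q. a (n, k) \<otimes> G k) = \<zero>\<^bsub>N\<^esub>"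
  using Q
proof (induction Q rule: finite_induct)
  case empty
  then show ?case
    by (simp add: free_lin_zero[OF ring_axioms] N.lincomb_zero)
next
  case (insert j Q)
  have aFL: "a \<in> FL" and col: "lincomb A N (\<lambda>n. a (n, j)) = \<zero>\<^bsub>N\<^esub>"
    using a by (auto simp: zero_cols_def)
  note ac = free_linD(1)[OF aFL] and af = free_lin_col[OF aFL, of j]
  have "(\<lambda>n. \<Oplus>k\<in>insert j Q. a (n, k) \<otimes> G k)
      = fl_add A (fl_smult A (G j) (\<lambda>n. a (n, j))) (\<lambda>n. \<Oplus>k\<in>Q. a (n, k) \<otimes> G k)"
    using insert.hyps ac G by (auto simp: fl_add_def fl_smult_def m_comm)
  then show ?case
    using insert.IH af col G
    by (simp add: free_lin_add free_lin_smult N.lincomb_add N.lincomb_smult)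
qed

text \<open>
  The vector \<open>G\<close> in the proof is a generalized inverse of the row \<open>c\<close>, that is, \<open>c G\<close> acts as the identity on
  the entries of \<open>c\<close>; the new matrix is \<open>a (1 - G c)\<close>. Its columns combine columns of \<open>a\<close>, and its rows
  differ from those of \<open>a\<close> by multiples of \<open>c\<close>, so both kinds of sums survive.
\<close>

lemma eliminate_row:
  assumes vnr: "von_neumann_regular A" and a: "a \<in> zero_cols A N M"
    and l: "lincomb A M (\<lambda>m. a (l, m)) = \<zero>\<^bsub>M\<^esub>"
  shows "\<exists>b\<in>zero_cols A N M. (\<forall>n. lincomb A M (\<lambda>m. b (n, m)) = lincomb A M (\<lambda>m. a (n, m))) \<and>
    (\<forall>m. b (l, m) = \<zero>) \<and> (\<forall>n. (\<forall>m. a (n, m) = \<zero>) \<longrightarrow> (\<forall>m. b (n, m) = \<zero>))"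
proof -
  have aFL: "a \<in> FL"
    using a by (simp add: zero_cols_def)
  note ac = free_linD(1)[OF aFL]
  define c where "c = (\<lambda>m. a (l, m))"
  have cf: "c \<in> free_lin A (carrier M)"
    unfolding c_def by (rule free_lin_row[OF aFL])
  note cc = free_linD(1)[OF cf]
  define Q where "Q = {m. c m \<noteq> \<zero>}"
  have Q: "finite Q"
    unfolding Q_def by (rule free_linD(3)[OF cf])
  obtain G where G: "\<And>k. G k \<in> carrier A" "\<And>m. m \<in> Q \<Longrightarrow> (\<Oplus>k\<in>Q. c k \<otimes> G k) \<otimes> c m = c m"
    using vnr_row_inverse[where c = c, OF vnr Q cc] by blast
  define t where "t = (\<lambda>n. \<Oplus>k\<in>Q. a (n, k) \<otimes> G k)"
  have t: "t \<in> free_lin A (carrier N)" "lincomb A N t = \<zero>\<^bsub>N\<^esub>"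
    using lincomb_finsum_cols[OF a Q G(1)] by (auto simp: t_def)
  note tc = free_linD(1)[OF t(1)]
  define w where "w = (\<lambda>(n, m). t n \<otimes> c m)"
  have "{x. w x \<noteq> \<zero>} \<subseteq> {n. t n \<noteq> \<zero>} \<times> {m. c m \<noteq> \<zero>}"
    using tc cc by (auto simp: w_def)
  then have "finite {x. w x \<noteq> \<zero>}"
    using free_linD(3)[OF t(1)] free_linD(3)[OF cf] by (auto intro: finite_subset)
  then have wFL: "w \<in> FL"
    using tc cc free_linD(2)[OF t(1)] free_linD(2)[OF cf]
    unfolding free_lin_def by (auto simp: w_def)
  define b where "b = fl_minus A a w"
  have bFL: "b \<in> FL"
    unfolding b_def by (rule free_lin_minus[OF aFL wFL])
  have wcol: "(\<lambda>n. w (n, m)) = fl_smult A (c m) t" for m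
    using tc cc by (auto simp: w_def fl_smult_def m_comm)
  have wrow: "(\<lambda>m. w (n, m)) = fl_smult A (t n) c" for n
    by (auto simp: w_def fl_smult_def)
  have "lincomb A N (\<lambda>n. b (n, m)) = \<zero>\<^bsub>N\<^esub>" for m
    using a t cc unfolding b_def fl_component wcol
    by (simp add: N.lincomb_minus free_lin_col[OF aFL] free_lin_smult N.lincomb_smult
        zero_cols_def a_minus_def)
  then have bz: "b \<in> zero_cols A N M"
    using bFL by (simp add: zero_cols_def)
  have rows: "lincomb A M (\<lambda>m. b (n, m)) = lincomb A M (\<lambda>m. a (n, m))" for n
  proof -
    have "lincomb A M c = \<zero>\<^bsub>M\<^esub>"
      using l by (simp add: c_def)
    then show ?thesis
      using tc cf M.lincomb_closed[OF free_lin_row[OF aFL]] unfolding b_def fl_component wrow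
      by (simp add: M.lincomb_minus free_lin_row[OF aFL] free_lin_smult M.lincomb_smult
          a_minus_def)
  qed
  have "b (l, m) = \<zero>" for m
  proof -
    \<comment> \<open>For m in \<open>Q\<close> this is the choice of \<open>G\<close>, since row l
      is \<open>c\<close> itself; for other m the entry \<open>c m\<close> is zero.\<close>
    have "t l \<otimes> c m = c m"
      using G(2)[of m] cc tc by (cases "m \<in> Q") (simp_all add: t_def c_def Q_def)
    then show ?thesis
      using cc[of m] by (simp add: b_def fl_minus_def w_def a_minus_def c_def r_neg)
  qed
  moreover have "b (n, m) = \<zero>" if n: "\<forall>m. a (n, m) = \<zero>" for n m
  proof -
    have "t n = (\<Oplus>k\<in>Q. \<zero>)"
      unfolding t_def using n G(1) by (intro finsum_cong') auto
    then show ?thesis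
      using n cc by (simp add: b_def fl_minus_def w_def a_minus_def)
  qed
  ultimately show ?thesis
    using bz rows by blast
qed

text \<open>Two invariants drive the iteration: preserved row sums keep the remaining rows of
  \<open>L\<close> eligible for elimination, and preserved zero rows keep the cleared ones clear.
  The latter also ensures that no new nonzero row appears outside \<open>L\<close>.\<close>

lemma eliminate_rows:
  assumes vnr: "von_neumann_regular A" and L: "finite L" and a: "a \<in> zero_cols A N M"
    and l: "\<And>l. l \<in> L \<Longrightarrow> lincomb A M (\<lambda>m. a (l, m)) = \<zero>\<^bsub>M\<^esub>"
  shows "\<exists>b\<in>zero_cols A N M. (\<forall>n. lincomb A M (\<lambda>m. b (n, m)) = lincomb A M (\<lambda>m. a (n, m))) \<and>
    (\<forall>l\<in>L. \<forall>m. b (l, m) = \<zero>) \<and> (\<forall>n. (\<forall>m. a (n, m) = \<zero>) \<longrightarrow> (\<forall>m. b (n, m) = \<zero>))"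
  using L l
proof (induction L rule: finite_induct)
  case empty
  then show ?case using a by blast
next
  case (insert j L)
  then obtain b where b: "b \<in> zero_cols A N M"
    "\<And>n. lincomb A M (\<lambda>m. b (n, m)) = lincomb A M (\<lambda>m. a (n, m))"
    "\<And>l m. l \<in> L \<Longrightarrow> b (l, m) = \<zero>" "\<And>n m. (\<forall>m. a (n, m) = \<zero>) \<Longrightarrow> b (n, m) = \<zero>"
    by (metis insertCI)
  obtain d where d: "d \<in> zero_cols A N M"
    "\<And>n. lincomb A M (\<lambda>m. d (n, m)) = lincomb A M (\<lambda>m. b (n, m))"
    "\<And>m. d (j, m) = \<zero>" "\<And>n m. (\<forall>m. b (n, m) = \<zero>) \<Longrightarrow> d (n, m) = \<zero>"
    using eliminate_row[OF vnr b(1), of j] b(2)[of j] insert.prems[of j] by auto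
  show ?case
  proof (intro bexI conjI allI ballI impI)
    show "d \<in> zero_cols A N M" by (rule d(1))
    show "lincomb A M (\<lambda>m. d (n, m)) = lincomb A M (\<lambda>m. a (n, m))" for n
      using d(2) b(2) by simp
    show "d (l, m) = \<zero>" if "l \<in> insert j L" for l m
      using that d(3,4) b(3) by blast
    show "d (n, m) = \<zero>" if "\<forall>m. a (n, m) = \<zero>" for n m
      using that d(4) b(4) by blast
  qed
qed

end

section \<open>Pulling relations back along an injection\<close>

locale injective_module_hom = cring A for A :: "('a, 'r) ring_scheme" (structure) +
  fixes N' :: "('a, 'n1) module" and N :: "('a, 'n2) module" and M :: "('a, 'm) module"
    and f :: "'n1 \<Rightarrow> 'n2"
  assumes N'_mod: "module A N'" and N_mod: "module A N" and M_mod: "module A M"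
    and f_hom: "f \<in> module_hom A N' N" and f_inj: "inj_on f (carrier N')"

sublocale injective_module_hom \<subseteq> S: tensor_modules A N' M
  by (rule tensor_modules.intro[OF is_cring tensor_modules_axioms.intro[OF N'_mod M_mod]])

sublocale injective_module_hom \<subseteq> T: tensor_modules A N M
  by (rule tensor_modules.intro[OF is_cring tensor_modules_axioms.intro[OF N_mod M_mod]])

context injective_module_hom
begin

lemma f_simps:
  "x \<in> carrier N' \<Longrightarrow> f x \<in> carrier N"
  "x \<in> carrier N' \<Longrightarrow> y \<in> carrier N' \<Longrightarrow> f (x \<oplus>\<^bsub>N'\<^esub> y) = f x \<oplus>\<^bsub>N\<^esub> f y"
  "c \<in> carrier A \<Longrightarrow> x \<in> carrier N' \<Longrightarrow> f (c \<odot>\<^bsub>N'\<^esub> x) = c \<odot>\<^bsub>N\<^esub> f x"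
  using f_hom unfolding module_hom_def by blast+

lemma f_zero: "f \<zero>\<^bsub>N'\<^esub> = \<zero>\<^bsub>N\<^esub>"
proof -
  have "f (\<zero> \<odot>\<^bsub>N'\<^esub> \<zero>\<^bsub>N'\<^esub>) = \<zero> \<odot>\<^bsub>N\<^esub> f \<zero>\<^bsub>N'\<^esub>"
    by (rule f_simps(3)) simp_all
  then show ?thesis
    using f_simps(1)[of "\<zero>\<^bsub>N'\<^esub>"] by simp
qed

text \<open>Injectivity leaves at most one summand in each fibre, so pushing forward merely relabels
  rows.\<close>

lemma fl_push_image:
  assumes z: "z \<in> free_lin A (carrier N' \<times> carrier M)" and n: "n \<in> carrier N'"
  shows "fl_push A N' f z (f n, m) = z (n, m)"
proof -
  have "{n'. n' \<in> carrier N' \<and> f n' = f n \<and> z (n', m) \<noteq> \<zero>} = (if z (n, m) = \<zero> then {} else {n})"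
    using n f_inj by (auto dest: inj_onD)
  then show ?thesis
    using free_linD(1)[OF z] by (simp add: fl_push_def)
qed

lemma fl_push_not_image:
  assumes "n \<notin> f ` carrier N'"
  shows "fl_push A N' f z (n, m) = \<zero>"
proof -
  have "{n'. n' \<in> carrier N' \<and> f n' = n \<and> z (n', m) \<noteq> \<zero>} = {}"
    using assms by auto
  then show ?thesis
    by (simp only: fl_push_def prod.case finsum_empty)
qed

lemma fl_push_minus:
  assumes z: "z \<in> free_lin A (carrier N' \<times> carrier M)" and w: "w \<in> free_lin A (carrier N' \<times> carrier M)"
  shows "fl_push A N' f (fl_minus A z w) = fl_minus A (fl_push A N' f z) (fl_push A N' f w)"
proof
  fix x :: "'n2 \<times> 'm"
  obtain n m where x: "x = (n, m)" by (cases x)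
  show "fl_push A N' f (fl_minus A z w) x = fl_minus A (fl_push A N' f z) (fl_push A N' f w) x"
  proof (cases "n \<in> f ` carrier N'")
    case True
    then show ?thesis
      using fl_push_image[OF z] fl_push_image[OF w] fl_push_image[OF free_lin_minus[OF z w]]
      unfolding x by (auto simp: fl_minus_def)
  next
    case False
    then show ?thesis
      unfolding x by (simp add: fl_push_not_image fl_minus_def a_minus_def)
  qed
qed

lemma fl_push_FL:
  assumes z: "z \<in> free_lin A (carrier N' \<times> carrier M)"
  shows "fl_push A N' f z \<in> free_lin A (carrier N \<times> carrier M)"
proof -
  have val: "fl_push A N' f z (n, m) = \<zero> \<or>
      (\<exists>n'\<in>carrier N'. n = f n' \<and> fl_push A N' f z (n, m) = z (n', m))" for n m
    using fl_push_image[OF z] fl_push_not_image[of n z m] by blast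
  have "{x. fl_push A N' f z x \<noteq> \<zero>} \<subseteq> map_prod f id ` {x. z x \<noteq> \<zero>}"
  proof
    fix x assume "x \<in> {x. fl_push A N' f z x \<noteq> \<zero>}"
    then obtain n' where "x = map_prod f id (n', snd x)" "z (n', snd x) \<noteq> \<zero>"
      using val[of "fst x" "snd x"] by (auto simp: prod_eq_iff)
    then show "x \<in> map_prod f id ` {x. z x \<noteq> \<zero>}"
      by blast
  qed
  then have "finite {x. fl_push A N' f z x \<noteq> \<zero>}"
    using free_linD(3)[OF z] finite_subset by blast
  moreover have "fl_push A N' f z (n, m) \<in> carrier A" for n m
    using val[of n m] free_linD(1)[OF z] by auto
  moreover have "fl_push A N' f z (n, m) = \<zero>" if "(n, m) \<notin> carrier N \<times> carrier M" for n m
    using val[of n m] that f_simps(1) free_linD(2)[OF z] by auto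
  ultimately show ?thesis
    by (auto simp: free_lin_def)
qed

text \<open>On coefficients supported in the image, f matches the supports bijectively, so the sum
  can be reindexed. This carries column sums of the edited matrix back to N'.\<close>

lemma hom_lincomb:
  assumes c: "c \<in> free_lin A (carrier N)" and supp: "\<And>n. n \<notin> f ` carrier N' \<Longrightarrow> c n = \<zero>"
  shows "(\<lambda>n. if n \<in> carrier N' then c (f n) else \<zero>) \<in> free_lin A (carrier N')"
    and "f (lincomb A N' (\<lambda>n. if n \<in> carrier N' then c (f n) else \<zero>)) = lincomb A N c"
proof -
  let ?d = "\<lambda>n. if n \<in> carrier N' then c (f n) else \<zero>"
  let ?P = "{n \<in> carrier N'. c (f n) \<noteq> \<zero>}"
  note cc = free_linD(1)[OF c]
  have img: "f ` ?P = {n. c n \<noteq> \<zero>}"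
  proof (intro equalityI subsetI)
    fix n assume n: "n \<in> {n. c n \<noteq> \<zero>}"
    then obtain n' where "n' \<in> carrier N'" "n = f n'"
      using supp by blast
    then show "n \<in> f ` ?P"
      using n by blast
  qed blast
  have inj: "inj_on f ?P"
    using f_inj by (rule inj_on_subset) auto
  have fin: "finite ?P"
    by (rule finite_imageD[OF _ inj]) (simp only: img free_linD(3)[OF c])
  show d: "?d \<in> free_lin A (carrier N')"
  proof -
    have "{n. ?d n \<noteq> \<zero>} = ?P"
      by auto
    then show ?thesis
      using cc fin unfolding free_lin_def by simp
  qed
  have step: "f (\<Oplus>\<^bsub>N'\<^esub>n\<in>F. c (f n) \<odot>\<^bsub>N'\<^esub> n) = (\<Oplus>\<^bsub>N\<^esub>n\<in>F. c (f n) \<odot>\<^bsub>N\<^esub> f n)"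
    if "finite F" "F \<subseteq> carrier N'" for F
    using that
  proof (induction F rule: finite_induct)
    case empty
    then show ?case by (simp add: f_zero)
  next
    case (insert j F)
    then have "(\<Oplus>\<^bsub>N'\<^esub>n\<in>F. c (f n) \<odot>\<^bsub>N'\<^esub> n) \<in> carrier N'"
      using cc by (intro S.N.M.finsum_closed) auto
    moreover have "(\<lambda>n. c (f n) \<odot>\<^bsub>N'\<^esub> n) \<in> F \<rightarrow> carrier N'" "(\<lambda>n. c (f n) \<odot>\<^bsub>N\<^esub> f n) \<in> F \<rightarrow> carrier N"
      using insert.prems cc f_simps(1) by auto
    ultimately show ?case
      using insert cc by (simp add: f_simps S.N.M.finsum_insert T.N.M.finsum_insert)
  qed
  have "lincomb A N' ?d = (\<Oplus>\<^bsub>N'\<^esub>n\<in>?P. ?d n \<odot>\<^bsub>N'\<^esub> n)"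
    using fin d by (intro S.N.lincomb_superset) auto
  also have "\<dots> = (\<Oplus>\<^bsub>N'\<^esub>n\<in>?P. c (f n) \<odot>\<^bsub>N'\<^esub> n)"
    using cc by (intro S.N.M.finsum_cong') auto
  finally have "f (lincomb A N' ?d) = (\<Oplus>\<^bsub>N\<^esub>n\<in>?P. c (f n) \<odot>\<^bsub>N\<^esub> f n)"
    using step[OF fin] by simp
  also have "\<dots> = (\<Oplus>\<^bsub>N\<^esub>n\<in>f ` ?P. c n \<odot>\<^bsub>N\<^esub> n)"
    using cc f_simps(1) inj by (intro T.N.M.finsum_reindex[symmetric]) auto
  also have "\<dots> = lincomb A N c"
    unfolding img lincomb_def ..
  finally show "f (lincomb A N' ?d) = lincomb A N c" .
qed

text \<open>Both parts of the decomposition may leave the image of N' and cancel there. It is enough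
  to bring the zero-column part back into the image; the other part is then recovered as a
  difference on N'.\<close>

lemma tensor_span_pullback:
  assumes vnr: "von_neumann_regular A" and z: "z \<in> free_lin A (carrier N' \<times> carrier M)"
    and push: "fl_push A N' f z \<in> tensor_span A N M"
  shows "z \<in> tensor_span A N' M"
proof -
  obtain a r where a: "a \<in> zero_cols A N M" and r: "r \<in> zero_rows A N M"
    and ar: "fl_push A N' f z = fl_add A a r"
    using T.tensor_span_decompose[OF push] by blast
  have aFL: "a \<in> T.FL" and rFL: "r \<in> T.FL"
    using a r by (auto simp: zero_cols_def zero_rows_def)
  have row_sum: "lincomb A M (\<lambda>m. a (n, m)) = lincomb A M (\<lambda>m. fl_push A N' f z (n, m))" for n
  proof -
    have "lincomb A M (\<lambda>m. fl_add A a r (n, m)) = lincomb A M (\<lambda>m. a (n, m)) \<oplus>\<^bsub>M\<^esub> lincomb A M (\<lambda>m. r (n, m))"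
      unfolding fl_component by (intro S.M.lincomb_add free_lin_row[OF aFL] free_lin_row[OF rFL])
    then show ?thesis
      using r S.M.lincomb_closed[OF free_lin_row[OF aFL]] unfolding ar
      by (simp add: zero_rows_def)
  qed
  \<comment> \<open>Off the image the pushed matrix is zero, so by \<open>row_sum\<close> the rows
    of a there sum to zero in M, as elimination requires. Only the finitely many nonzero ones have
    to be cleared.\<close>
  define L where "L = {n. n \<notin> f ` carrier N' \<and> (\<exists>m. a (n, m) \<noteq> \<zero>)}"
  have "L \<subseteq> fst ` {x. a x \<noteq> \<zero>}"
    by (force simp: L_def)
  then have L: "finite L"
    using free_linD(3)[OF aFL] finite_subset by blast
  have "lincomb A M (\<lambda>m. a (l, m)) = \<zero>\<^bsub>M\<^esub>" if "l \<in> L" for l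
    using that unfolding row_sum by (simp add: L_def fl_push_not_image S.M.lincomb_zero)
  then obtain b where b: "b \<in> zero_cols A N M"
    "\<And>n. lincomb A M (\<lambda>m. b (n, m)) = lincomb A M (\<lambda>m. a (n, m))"
    "\<And>l m. l \<in> L \<Longrightarrow> b (l, m) = \<zero>" "\<And>n m. (\<forall>m. a (n, m) = \<zero>) \<Longrightarrow> b (n, m) = \<zero>"
    using T.eliminate_rows[OF vnr L a] by blast
  have bFL: "b \<in> T.FL"
    using b(1) by (simp add: zero_cols_def)
  have b_supp: "b (n, m) = \<zero>" if "n \<notin> f ` carrier N'" for n m
    using that b(3,4)[of n m] by (auto simp: L_def)
  define d where "d = (\<lambda>(n, m). if n \<in> carrier N' then b (f n, m) else \<zero>)"
  have d_col: "(\<lambda>n. d (n, m)) = (\<lambda>n. if n \<in> carrier N' then b (f n, m) else \<zero>)" for m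
    by (simp add: d_def)
  have dFL: "d \<in> S.FL"
  proof -
    have "map_prod f id ` {x. d x \<noteq> \<zero>} \<subseteq> {x. b x \<noteq> \<zero>}"
      by (auto simp: d_def split: if_splits)
    then have "finite (map_prod f id ` {x. d x \<noteq> \<zero>})"
      using free_linD(3)[OF bFL] finite_subset by blast
    moreover have "inj_on (map_prod f id) {x. d x \<noteq> \<zero>}"
      using f_inj by (auto simp: inj_on_def d_def split: if_splits)
    ultimately have "finite {x. d x \<noteq> \<zero>}"
      by (rule finite_imageD)
    then show ?thesis
      using free_linD(1,2)[OF bFL] by (auto simp: free_lin_def d_def)
  qed
  have "lincomb A N' (\<lambda>n. d (n, m)) = \<zero>\<^bsub>N'\<^esub>" for m
  \<comment> \<open>The column sum is known to vanish only after applying f; injectivity removes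
    f.\<close>
  proof (rule inj_onD[OF f_inj])
    have "f (lincomb A N' (\<lambda>n. d (n, m))) = lincomb A N (\<lambda>n. b (n, m))"
      unfolding d_col using hom_lincomb(2)[OF free_lin_col[OF bFL] b_supp] by simp
    then show "f (lincomb A N' (\<lambda>n. d (n, m))) = f \<zero>\<^bsub>N'\<^esub>"
      using b(1) by (simp add: zero_cols_def f_zero)
    show "lincomb A N' (\<lambda>n. d (n, m)) \<in> carrier N'"
      by (rule S.N.lincomb_closed[OF free_lin_col[OF dFL]])
  qed simp
  then have dz: "d \<in> zero_cols A N' M"
    using dFL by (simp add: zero_cols_def)
  \<comment> \<open>The zero-row part on N': elimination preserved row sums, and those of a agree
    with those of the pushed z, so d and z have equal row sums.\<close>
  define s where "s = fl_minus A z d"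
  have sFL: "s \<in> S.FL"
    unfolding s_def by (rule free_lin_minus[OF z dFL])
  have "lincomb A M (\<lambda>m. s (n, m)) = \<zero>\<^bsub>M\<^esub>" for n
  proof (cases "n \<in> carrier N'")
    case True
    then have "lincomb A M (\<lambda>m. d (n, m)) = lincomb A M (\<lambda>m. z (n, m))"
      using b(2)[of "f n"] row_sum[of "f n"] by (simp add: d_def fl_push_image[OF z])
    then show ?thesis
      using S.M.lincomb_minus[OF free_lin_row[OF z] free_lin_row[OF dFL], of n n]
        S.M.lincomb_closed[OF free_lin_row[OF z, of n]]
      unfolding s_def fl_component by (simp add: a_minus_def S.M.M.r_neg)
  next
    case False
    then have "(\<lambda>m. s (n, m)) = (\<lambda>_. \<zero>)"
      using free_linD(2)[OF sFL] by auto
    then show ?thesis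
      by (simp add: S.M.lincomb_zero)
  qed
  then have sz: "s \<in> zero_rows A N' M"
    using sFL by (simp add: zero_rows_def)
  have "z x = d x \<oplus> (z x \<ominus> d x)" for x
    using free_linD(1)[OF z, of x] free_linD(1)[OF dFL, of x] by algebra
  then have "z = fl_add A d s"
    by (auto simp: s_def fl_add_def fl_minus_def)
  then show ?thesis
    using tensor_span.ts_add[of d A N' M s] S.zero_cols_subset_span S.zero_rows_subset_span dz sz by auto
qed

text \<open>Pushing forward respects differences of representatives, so injectivity on classes
  reduces to pulling a single relation back.\<close>

lemma inj_on_tensor_map:
  assumes vnr: "von_neumann_regular A"
  shows "inj_on (tensor_map A N' N M f) (tensor_carrier A N' M)"
proof (rule inj_onI)
  fix U1 U2
  assume U: "U1 \<in> tensor_carrier A N' M" "U2 \<in> tensor_carrier A N' M"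
    and eq: "tensor_map A N' N M f U1 = tensor_map A N' N M f U2"
  have cls: "w \<in> tensor_class A N' M z \<longleftrightarrow> S.tcong w z" if "z \<in> S.FL" for w z
    unfolding tensor_class_def S.tcong_def using that by blast
  have clsT: "w \<in> tensor_class A N M z \<longleftrightarrow> T.tcong w z" if "z \<in> T.FL" for w z
    unfolding tensor_class_def T.tcong_def using that by blast
  obtain z1 z2 where z: "z1 \<in> S.FL" "U1 = tensor_class A N' M z1" "z2 \<in> S.FL" "U2 = tensor_class A N' M z2"
    using U unfolding tensor_carrier_def by blast
  have z1: "z1 \<in> U1"
    using z S.tcong_refl cls by blast
  have pz1: "fl_push A N' f z1 \<in> tensor_class A N M (fl_push A N' f z1)"
    using clsT T.tcong_refl fl_push_FL[OF z(1)] by blast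
  \<comment> \<open>The image of a class is a union of classes. Equality of two images is exploited
    through this one member, which must lie in the class of the push of some representative w of
    \<open>U2\<close>.\<close>
  have "fl_push A N' f z1 \<in> tensor_map A N' N M f U1"
    unfolding tensor_map_def
    by (rule UN_I[where B = "\<lambda>z. tensor_class A N M (fl_push A N' f z)", OF z1 pz1])
  then have "fl_push A N' f z1 \<in> tensor_map A N' N M f U2"
    by (simp only: eq)
  then obtain w where w: "w \<in> U2" "fl_push A N' f z1 \<in> tensor_class A N M (fl_push A N' f w)"
    unfolding tensor_map_def by (rule UN_E)
  have wFL: "w \<in> S.FL"
    using w(1) unfolding z(4) tensor_class_def by simp
  have "fl_push A N' f (fl_minus A z1 w) \<in> tensor_span A N M"
    using w(2) unfolding fl_push_minus[OF z(1) wFL] tensor_class_def by simp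
  then have "fl_minus A z1 w \<in> tensor_span A N' M"
    by (rule tensor_span_pullback[OF vnr free_lin_minus[OF z(1) wFL]])
  then have "S.tcong z1 w"
    using z(1) wFL by (simp add: S.tcong_def)
  moreover have "S.tcong w z2"
    using w(1) cls[OF z(3)] z(4) by blast
  ultimately have "S.tcong z1 z2"
    by (rule S.tcong_trans)
  then have "S.tcong v z1 \<longleftrightarrow> S.tcong v z2" for v
    using S.tcong_trans S.tcong_sym by blast
  then show "U1 = U2"
    using cls[OF z(1)] cls[OF z(3)] z(2,4) by blast
qed

end

section \<open>Residue fields and flatness for the universal ring\<close>

theorem theorem3p8:
  shows "(\<forall>q. primeideal q (pinv_ring :: 'a::comm_ring_1 mpoly set ring) \<longrightarrow>
            field (loc_at (pinv_ring :: 'a mpoly set ring) q) \<and>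
            residue_induced (type_ring :: 'a ring) (pinv_eta -` q) (pinv_ring :: 'a mpoly set ring) q pinv_eta
              \<in> ring_iso (residue_field (type_ring :: 'a ring) (pinv_eta -` q))
                         (loc_at (pinv_ring :: 'a mpoly set ring) q)) \<and>
         (\<forall>(M :: ('a mpoly set, 'm) module) (N' :: ('a mpoly set, 'n1) module)
            (N :: ('a mpoly set, 'n2) module) f.
            module (pinv_ring :: 'a mpoly set ring) M \<longrightarrow> flat_for pinv_ring M N' N f)"
proof (intro conjI allI impI)
  interpret B: pointwise_inverse_ring "pinv_ring :: 'a mpoly set ring" pinv_eta
    "\<lambda>s. pinv_ideal +>\<^bsub>type_ring\<^esub> mp_var s"
    by (rule pointwise_inverse_ring_pinv_ring)
  fix q assume q: "primeideal q (pinv_ring :: 'a mpoly set ring)"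
  show "field (loc_at (pinv_ring :: 'a mpoly set ring) q)"
    by (rule B.vnr_loc_at_field(1)[OF B.regular q])
  show "residue_induced (type_ring :: 'a ring) (pinv_eta -` q) pinv_ring q pinv_eta
      \<in> ring_iso (residue_field type_ring (pinv_eta -` q)) (loc_at pinv_ring q)"
    by (rule B.residue_induced_iso[OF q])
next
  fix M :: "('a mpoly set, 'm) module" and N' :: "('a mpoly set, 'n1) module"
    and N :: "('a mpoly set, 'n2) module" and f
  interpret B: pointwise_inverse_ring "pinv_ring :: 'a mpoly set ring" pinv_eta
    "\<lambda>s. pinv_ideal +>\<^bsub>type_ring\<^esub> mp_var s"
    by (rule pointwise_inverse_ring_pinv_ring)
  assume M: "module (pinv_ring :: 'a mpoly set ring) M"
  show "flat_for pinv_ring M N' N f"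
    unfolding flat_for_def
  proof (intro impI, elim conjE)
    assume hyps: "module (pinv_ring :: 'a mpoly set ring) N'" "module (pinv_ring :: 'a mpoly set ring) N"
      "f \<in> module_hom (pinv_ring :: 'a mpoly set ring) N' N" "inj_on f (carrier N')"
    interpret injective_module_hom "pinv_ring :: 'a mpoly set ring" N' N M f
      by (rule injective_module_hom.intro[OF B.is_cring
          injective_module_hom_axioms.intro[OF hyps(1,2) M hyps(3,4)]])
    show "inj_on (tensor_map pinv_ring N' N M f) (tensor_carrier pinv_ring N' M)"
      by (rule inj_on_tensor_map[OF B.regular])
  qed
qed

end
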